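(* Let $b\in\mathscr{S}(n)$ and $\alpha\in\mathcal{U}(n)$. Then for $\mu^\alpha_{\mathrm{s}}$-a.e. $\lambda\in\mathbb{T}$ the following holds: for every $\mathbf{e}\in\operatorname{Ran}W^\alpha(\lambda)$ the non-tangential limit $\lim_{z\to\lambda\ \text{n.t.}}b(z)^*\mathbf{e}$ exists and is equal to $\alpha^*\mathbf{e}$.
   Context: $\mathbb{D}$ is the open unit disc and $\mathbb{T}=\partial\mathbb{D}$. $\mathscr{S}(n)$ is the set of bounded analytic $n\times n$ matrix-valued functions $b$ on $\mathbb{D}$ with $\|b(z)\|<1$ (operator norm) for all $z\in\mathbb{D}$. $\mathcal{U}(n)$ is the group of unitary $n\times n$ matrices. For $b\in\mathscr{S}(n)$ and $\alpha\in\mathcal{U}(n)$, the Aleksandrov--Clark measure $\boldsymbol{\mu}^\alpha$ is the unique finite non-negative $\mathbb{C}^{n\times n}$-valued Borel measure on $\mathbb{T}$ such that, with $H_\alpha(z)=(I_n+b(z)\alpha^* )(I_n-b(z)\alpha^* )^{-1}$, $$H_\alpha(z)=i\,\mathrm{Im}\,H_\alpha(0)+\int_{\mathbb{T}}\frac{\zeta+z}{\zeta-z}\,\boldsymbol{\mu}^\alpha(\mathrm{d}\zeta),\qquad z\in\mathbb{D},$$ where $\mathrm{Im}\,A=(A-A^* )/(2i)$. $\mu^\alpha=\operatorname{tr}\boldsymbol{\mu}^\alpha$ is the (scalar) trace measure, $\mu^\alpha_{\mathrm{s}}$ is its singular part with respect to Lebesgue measure on $\mathbb{T}$, and $W^\alpha$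 is the measurable positive semidefinite matrix-valued density with $\mathrm{d}\boldsymbol{\mu}^\alpha=W^\alpha\,\mathrm{d}\mu^\alpha$ (defined $\mu^\alpha$-a.e.). The non-tangential ("n.t.") limit $z\to\lambda$ means the limit from within every Stolz region $\Gamma_t(\lambda)=\{z\in\mathbb{D}:|z-\lambda|<t(1-|z|)\}$, $t>1$. *)

theory Defs
  imports "HOL-Analysis.Analysis"
begin

definition cdot :: "complex^'n \<Rightarrow> complex^'n \<Rightarrow> complex" where
  "cdot u v = (\<Sum>i\<in>UNIV. u $ i * cnj (v $ i))"

definition cadj :: "complex^'n^'m \<Rightarrow> complex^'m^'n" where
  "cadj A = (\<chi> i j. cnj (A $ j $ i))"

definition unitary :: "complex^'n^'n \<Rightarrow> bool" where
  "unitary U \<longleftrightarrow> cadj U ** U = mat 1 \<and> U ** cadj U = mat 1"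

definition psd :: "complex^'n^'n \<Rightarrow> bool" where
  "psd A \<longleftrightarrow> cadj A = A \<and> (\<forall>v. 0 \<le> Re (cdot (A *v v) v))"

text \<open>\<open>mat c\<close> is the scalar matrix with \<open>c\<close> on the diagonal.\<close>

definition mat_Im :: "complex^'n^'n \<Rightarrow> complex^'n^'n" where
  "mat_Im A = mat (1 / (2 * \<i>)) ** (A - cadj A)"

text \<open>The norm of \<open>complex^'n\<close> is the Euclidean one, so \<open>onorm\<close> is the usual operator norm.\<close>

definition schur_class :: "(complex \<Rightarrow> complex^'n^'n) set" where
  "schur_class = {b. (\<forall>i j. (\<lambda>z. b z $ i $ j) holomorphic_on ball 0 1)
     \<and> bounded (b ` ball 0 1)
     \<and> (\<forall>z\<in>ball 0 1. onorm (\<lambda>v. b z *v v) < 1)}"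

definition circle_borel :: "complex measure" where
  "circle_borel = restrict_space borel (sphere 0 1)"

text \<open>Arc length, not normalised to total mass 1; only its null sets matter below.\<close>

definition circle_lebesgue :: "complex measure" where
  "circle_lebesgue = distr (restrict_space lborel {0..<2 * pi}) circle_borel cis"

text \<open>Non-negative matrix-valued measures on the circle are countably additive set functions
  on its Borel sets; the values on other sets are irrelevant. They are automatically finite, and \<open>M {} = 0\<close>
  follows by taking all the sets empty.\<close>

definition psd_measure :: "(complex set \<Rightarrow> complex^'n^'n) \<Rightarrow> bool" where
  "psd_measure M \<longleftrightarrow>
     (\<forall>A\<in>sets circle_borel. psd (M A)) \<and>
     (\<forall>F :: nat \<Rightarrow> complex set. range F \<subseteq> sets circle_borel \<longrightarrow> disjoint_family F \<longrightarrow>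
        (\<lambda>k. M (F k)) sums M (\<Union>k. F k))"

definition trace_measure :: "(complex set \<Rightarrow> complex^'n^'n) \<Rightarrow> complex measure" where
  "trace_measure M = measure_of (space circle_borel) (sets circle_borel)
     (\<lambda>A. ennreal (Re (trace (M A))))"

definition form_measure :: "(complex set \<Rightarrow> complex^'n^'n) \<Rightarrow> complex^'n \<Rightarrow> complex measure" where
  "form_measure M v = measure_of (space circle_borel) (sets circle_borel)
     (\<lambda>A. ennreal (Re (cdot (M A *v v) v)))"

text \<open>The integral of a scalar function against \<open>M\<close> in the weak sense. By polarization the
  condition determines \<open>J\<close>, whose entries are the integrals of \<open>f\<close> against the complex
  measures given by the entries of \<open>M\<close>.\<close>

definition has_matrix_integral ::
  "(complex set \<Rightarrow> complex^'n^'n) \<Rightarrow> (complex \<Rightarrow> complex) \<Rightarrow> complex^'n^'n \<Rightarrow> bool" where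
  "has_matrix_integral M f J \<longleftrightarrow>
     (\<forall>v. integrable (form_measure M v) f \<and>
          cdot (J *v v) v = (LINT x|form_measure M v. f x))"

definition trace_density ::
  "(complex set \<Rightarrow> complex^'n^'n) \<Rightarrow> (complex \<Rightarrow> complex^'n^'n) \<Rightarrow> bool" where
  "trace_density M W \<longleftrightarrow>
     W \<in> borel_measurable (trace_measure M) \<and>
     (AE x in trace_measure M. psd (W x)) \<and>
     integrable (trace_measure M) W \<and>
     (\<forall>A\<in>sets circle_borel. M A = (LINT x:A|trace_measure M. W x))"

text \<open>\<open>\<nu>\<close> is the \<open>m\<close>-singular summand in the Lebesgue decomposition of \<open>\<mu>\<close>.\<close>

definition singular_part :: "'a measure \<Rightarrow> 'a measure \<Rightarrow> 'a measure \<Rightarrow> bool" where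
  "singular_part m \<mu> \<nu> \<longleftrightarrow>
     sets \<nu> = sets \<mu> \<and>
     (\<exists>N\<in>null_sets m. emeasure \<nu> (space \<nu> - N) = 0) \<and>
     (\<exists>\<rho>. sets \<rho> = sets \<mu> \<and> absolutely_continuous m \<rho> \<and>
        (\<forall>A\<in>sets \<mu>. emeasure \<mu> A = emeasure \<rho> A + emeasure \<nu> A))"

definition clark_H :: "(complex \<Rightarrow> complex^'n^'n) \<Rightarrow> complex^'n^'n \<Rightarrow> complex \<Rightarrow> complex^'n^'n" where
  "clark_H b \<alpha> z = (mat 1 + b z ** cadj \<alpha>) ** matrix_inv (mat 1 - b z ** cadj \<alpha>)"

definition AC_measure ::
  "(complex \<Rightarrow> complex^'n^'n) \<Rightarrow> complex^'n^'n \<Rightarrow> (complex set \<Rightarrow> complex^'n^'n) \<Rightarrow> bool" where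
  "AC_measure b \<alpha> M \<longleftrightarrow> psd_measure M \<and>
     (\<forall>z\<in>ball 0 1. \<exists>J. has_matrix_integral M (\<lambda>\<zeta>. (\<zeta> + z) / (\<zeta> - z)) J \<and>
        clark_H b \<alpha> z = mat \<i> ** mat_Im (clark_H b \<alpha> 0) + J)"

definition stolz :: "real \<Rightarrow> complex \<Rightarrow> complex set" where
  "stolz t \<xi> = {z \<in> ball 0 1. cmod (z - \<xi>) < t * (1 - cmod z)}"

definition nt_limit :: "(complex \<Rightarrow> 'a::topological_space) \<Rightarrow> complex \<Rightarrow> 'a \<Rightarrow> bool" where
  "nt_limit f \<xi> l \<longleftrightarrow> (\<forall>t>1. (f \<longlongrightarrow> l) (at \<xi> within stolz t \<xi>))"

end

theory Submission
  imports Defs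
begin

text \<open>Write \<open>B = b \<alpha>\<^sup>*\<close>, \<open>P\<close> and \<open>p\<close> for the Poisson integrals of \<open>W \<mu>\<^sup>\<alpha>\<close> and \<open>\<mu>\<^sup>\<alpha>\<close>. The real part of the
  Herglotz representation gives \<open>\<langle>P(1 - B)u, (1 - B)u\<rangle> = |u|\<^sup>2 - |Bu|\<^sup>2 \<le> |u|\<^sup>2\<close>, so by Cauchy--Schwarz for \<open>P\<close>
  the vector \<open>(1 - B\<^sup>*)Px/p\<close> has norm at most \<open>(\<langle>Px, x\<rangle>/p)\<^sup>1\<^sup>/\<^sup>2 p\<^sup>-\<^sup>1\<^sup>/\<^sup>2\<close>. At \<open>\<mu>\<^sub>s\<close>-almost every point
  \<open>P/p \<rightarrow> W\<close> and \<open>p \<rightarrow> \<infinity>\<close> non-tangentially, hence \<open>(1 - B\<^sup>*)Wx \<rightarrow> 0\<close>. Both boundary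
  statements follow from one differentiation theorem: if \<open>\<nu>\<close> vanishes on \<open>A\<close>, then \<open>\<nu>(I)/\<mu>(I) \<rightarrow> 0\<close> for arcs
  \<open>I\<close> shrinking to \<open>\<mu>\<close>-almost any point of \<open>A\<close>. It is applied with \<open>\<nu>\<close> Lebesgue measure, and with
  \<open>\<nu> = (|W - q| - 1/n)\<^sup>+ \<mu>\<close> on \<open>A = {|W - q| \<le> 1/n}\<close> for \<open>q\<close> in a countable dense set.\<close>

section \<open>The sesquilinear form of a matrix\<close>

lemma cdot_add_left: "cdot (u + v) w = cdot u w + cdot v w"
  by (simp add: cdot_def sum.distrib algebra_simps)

lemma cdot_diff_left: "cdot (u - v) w = cdot u w - cdot v w"
  by (simp add: cdot_def sum_subtractf algebra_simps)

lemma cdot_diff_right: "cdot u (v - w) = cdot u v - cdot u w"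
  by (simp add: cdot_def sum_subtractf algebra_simps)

lemma cdot_smult_left: "cdot (c *s u) v = c * cdot u v"
  by (simp add: cdot_def sum_distrib_left mult.assoc)

lemma cdot_smult_right: "cdot u (c *s v) = cnj c * cdot u v"
  by (simp add: cdot_def sum_distrib_left mult.left_commute)

lemma cdot_scaleR_left: "cdot (r *\<^sub>R u) v = r *\<^sub>R cdot u v"
  by (simp add: cdot_def scaleR_sum_right)

lemma cdot_commute: "cdot u v = cnj (cdot v u)"
  by (simp add: cdot_def mult.commute)

lemma cdot_self: "cdot v v = of_real ((norm v)\<^sup>2)"
  by (simp add: cdot_def norm_vec_def L2_set_def sum_nonneg complex_norm_square del: of_real_power)

lemma cdot_matrix_left: "cdot (A *v u) v = cdot u (cadj A *v v)"
proof -
  have "cdot (A *v u) v = (\<Sum>i\<in>UNIV. \<Sum>j\<in>UNIV. A $ i $ j * u $ j * cnj (v $ i))"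
    by (simp add: cdot_def matrix_vector_mult_def sum_distrib_right)
  also have "\<dots> = (\<Sum>j\<in>UNIV. \<Sum>i\<in>UNIV. A $ i $ j * u $ j * cnj (v $ i))"
    by (rule sum.swap)
  also have "\<dots> = cdot u (cadj A *v v)"
    by (simp add: cdot_def matrix_vector_mult_def cadj_def sum_distrib_left mult_ac)
  finally show ?thesis .
qed

lemma cadj_mat [simp]: "cadj (mat c) = mat (cnj c)"
  by (simp add: cadj_def mat_def vec_eq_iff)

lemma cadj_cadj [simp]: "cadj (cadj A) = A"
  by (simp add: cadj_def vec_eq_iff)

lemma cadj_diff: "cadj (A - B) = cadj A - cadj B"
  by (simp add: cadj_def vec_eq_iff)

lemma cadj_mult: "cadj (A ** B) = cadj B ** cadj A"
  by (simp add: cadj_def matrix_matrix_mult_def vec_eq_iff mult.commute)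

lemma psd_mat_1: "psd (mat 1)"
  by (simp add: psd_def cdot_self)

text \<open>Nonnegativity of the form at \<open>x - s \<beta> y\<close> for every real
  \<open>s\<close> gives a quadratic inequality in \<open>s\<close>; the factor
  \<open>\<beta>\<close> absorbs the phase. The form may be degenerate, so a vanishing leading
  coefficient is treated separately.\<close>

lemma psd_Cauchy_Schwarz:
  assumes "psd A"
  shows "(cmod (cdot (A *v x) y))\<^sup>2 \<le> Re (cdot (A *v x) x) * Re (cdot (A *v y) y)"
proof (cases "cdot (A *v x) y = 0")
  case True
  then show ?thesis using assms by (simp add: psd_def)
next
  case False
  define \<beta> where "\<beta> = cdot (A *v x) y"
  define m where "m = (cmod \<beta>)\<^sup>2"
  define a where "a = Re (cdot (A *v x) x)"
  define d where "d = Re (cdot (A *v y) y)"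
  have m: "m > 0" using False by (simp add: m_def \<beta>_def)
  have "d \<ge> 0" using assms by (simp add: psd_def d_def)
  have yx: "cdot (A *v y) x = cnj \<beta>"
    using assms unfolding \<beta>_def psd_def by (metis cdot_commute cdot_matrix_left)
  have mb: "cnj \<beta> * \<beta> = of_real m"
    by (simp add: m_def complex_norm_square mult.commute del: of_real_power)
  have quad: "0 \<le> a - 2 * s * m + s\<^sup>2 * m * d" for s :: real
  proof -
    define \<tau> where "\<tau> = of_real s * \<beta>"
    have "cdot (A *v (x - \<tau> *s y)) (x - \<tau> *s y) = cdot (A *v x) x - cnj \<tau> * \<beta> - \<tau> * cnj \<beta>
        + \<tau> * cnj \<tau> * cdot (A *v y) y"
      by (simp add: matrix_vector_mult_diff_distrib vector_scalar_commute cdot_diff_left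
          cdot_diff_right cdot_smult_left cdot_smult_right yx \<beta>_def[symmetric] algebra_simps)
    also have "\<dots> = cdot (A *v x) x - of_real (2 * s * m) + of_real (s\<^sup>2 * m) * cdot (A *v y) y"
      unfolding of_real_mult of_real_power mb[symmetric]
      by (simp add: \<tau>_def power2_eq_square algebra_simps)
    finally have "Re (cdot (A *v (x - \<tau> *s y)) (x - \<tau> *s y)) = a - 2 * s * m + s\<^sup>2 * m * d"
      by (simp add: a_def d_def)
    then show ?thesis using assms unfolding psd_def by metis
  qed
  have "m \<le> a * d"
  proof (cases "d = 0")
    case True
    \<comment> \<open>The bound in \<open>quad\<close> is now affine in \<open>s\<close> with slope
      \<open>- 2 * m\<close>, and this \<open>s\<close> gives it the value -1, a
      contradiction.\<close>
    then show ?thesis using quad[of "(a + 1) / (2 * m)"] m by simp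
  next
    case False
    then have "d > 0" using \<open>d \<ge> 0\<close> by simp
    \<comment> \<open>The quadratic in \<open>s\<close> is minimal at \<open>1 / d\<close>.\<close>
    then have "0 \<le> a - m / d"
      using quad[of "1 / d"] by (simp add: power2_eq_square field_simps)
    then show ?thesis using \<open>d > 0\<close> by (simp add: field_simps)
  qed
  then show ?thesis by (simp add: m_def \<beta>_def a_def d_def)
qed

lemma cdot_norm_le: "cmod (cdot u v) \<le> norm u * norm v"
proof -
  have "(cmod (cdot u v))\<^sup>2 \<le> (norm u * norm v)\<^sup>2"
    using psd_Cauchy_Schwarz[OF psd_mat_1, of u v] by (simp add: cdot_self power_mult_distrib)
  then show ?thesis by (rule power2_le_imp_le) simp
qed

lemma scaleR_matrix_apply: "(r *\<^sub>R A) *v v = r *\<^sub>R (A *v v :: complex^'n)"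
  by (simp add: matrix_vector_mult_def vec_eq_iff scaleR_sum_right)

lemma bounded_linear_cdot_matrix: "bounded_linear (\<lambda>A::complex^'n^'n. cdot (A *v v) w)"
proof -
  have "linear (\<lambda>A::complex^'n^'n. cdot (A *v v) w)"
    by (rule linearI) (simp_all add: cdot_add_left matrix_vector_mult_add_rdistrib
        cdot_scaleR_left scaleR_matrix_apply)
  then show ?thesis by (simp add: linear_conv_bounded_linear)
qed

lemma bounded_linear_matrix_apply: "bounded_linear (\<lambda>A::complex^'n^'n. A *v v)"
proof -
  have "linear (\<lambda>A::complex^'n^'n. A *v v)"
    by (rule linearI) (simp_all add: matrix_vector_mult_add_rdistrib
        scaleR_matrix_apply)
  then show ?thesis by (simp add: linear_conv_bounded_linear)
qed

lemma bounded_linear_cadj: "bounded_linear (cadj :: complex^'n^'n \<Rightarrow> complex^'n^'n)"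
proof -
  have "linear (cadj :: complex^'n^'n \<Rightarrow> complex^'n^'n)"
    by (rule linearI) (simp_all add: cadj_def vec_eq_iff)
  then show ?thesis by (simp add: linear_conv_bounded_linear)
qed

lemma norm_unitary:
  fixes U :: "complex^'n^'n"
  assumes "unitary U" shows "norm (U *v x) = norm x" "norm (cadj U *v x) = norm x"
proof -
  have *: "norm (V *v x) = norm x" if "cadj V ** V = mat 1" for V :: "complex^'n^'n" and x
  proof -
    have "cdot (V *v x) (V *v x) = cdot x x"
      by (simp add: cdot_matrix_left matrix_vector_mul_assoc that)
    then have "(norm (V *v x))\<^sup>2 = (norm x)\<^sup>2"
      unfolding cdot_self of_real_eq_iff .
    then show ?thesis by simp
  qed
  show "norm (U *v x) = norm x" "norm (cadj U *v x) = norm x"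
    using assms by (auto simp: unitary_def intro!: *)
qed

text \<open>The matrix is half of \<open>A - cadj A\<close>, hence skew-Hermitian. This is how the
  constant term of the Herglotz representation drops out of real parts.\<close>

lemma Re_cdot_i_mat_Im: "Re (cdot ((mat \<i> ** mat_Im A) *v v) v) = 0"
proof -
  have *: "mat c *v w = c *s w" for c :: complex and w :: "complex^'a"
    by (simp add: vec_eq_iff matrix_vector_mult_def mat_def if_distrib[of "\<lambda>x. x * _"] cong: if_cong)
  have "(mat \<i> ** mat_Im A) *v v = (1/2) *s ((A - cadj A) *v v)"
    by (simp add: mat_Im_def matrix_vector_mul_assoc[symmetric] *)
  moreover have "Re (cdot ((A - cadj A) *v v) v) = 0"
    using cdot_matrix_left[of "cadj A" v v] cdot_commute[of v "A *v v"]
    by (simp add: matrix_vector_mult_diff_rdistrib cdot_diff_left)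
  ultimately show ?thesis by (simp add: cdot_smult_left)
qed

section \<open>Borel sets and arcs of the circle\<close>

lemma space_circle_borel [simp]: "space circle_borel = sphere 0 1"
  by (simp add: circle_borel_def space_restrict_space)

lemma sets_circle_borel_iff: "A \<in> sets circle_borel \<longleftrightarrow> A \<subseteq> sphere 0 1 \<and> A \<in> sets borel"
  by (simp add: circle_borel_def sets_restrict_space_iff)

lemma sphere_Int_circle_borel:
  "A \<in> sets borel \<Longrightarrow> sphere 0 1 \<inter> A \<in> sets circle_borel"
  by (simp add: sets_circle_borel_iff)

text \<open>A subfamily of least cardinality with the same union contains no redundant member.\<close>

lemma minimal_subcover_overlap:
  assumes fin: "finite F"
    and three: "\<And>A B C x. \<lbrakk>A \<in> F; B \<in> F; C \<in> F; x \<in> A; x \<in> B; x \<in> C\<rbrakk>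
      \<Longrightarrow> A \<subseteq> B \<union> C \<or> B \<subseteq> A \<union> C \<or> C \<subseteq> A \<union> B"
  obtains G where "G \<subseteq> F" "\<Union>G = \<Union>F" "\<And>x. card {A\<in>G. x \<in> A} \<le> 2"
proof -
  let ?P = "\<lambda>G. G \<subseteq> F \<and> \<Union>G = \<Union>F"
  have "\<exists>G. ?P G \<and> (\<forall>G'. ?P G' \<longrightarrow> card G \<le> card G')"
    by (rule ex_has_least_nat[of ?P F]) simp
  then obtain G where G: "?P G" and min': "\<forall>G'. ?P G' \<longrightarrow> card G \<le> card G'"
    by (elim exE conjE) (rule that, simp_all)
  have min: "card G \<le> card G'" if "?P G'" for G' using min'[rule_format, OF that] .
  have finG: "finite G" using G fin by (elim conjE) (rule finite_subset)
  have "card {A\<in>G. x \<in> A} \<le> 2" for x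
  proof (rule ccontr)
    assume "\<not> ?thesis"
    then have "3 \<le> card {A\<in>G. x \<in> A}" by simp
    then obtain T where T: "T \<subseteq> {A\<in>G. x \<in> A}" "card T = 3"
      by (meson obtain_subset_with_card_n)
    from T(2) obtain A B C where ABC: "T = {A, B, C}" "A \<noteq> B" "A \<noteq> C" "B \<noteq> C"
      unfolding card_3_iff by blast
    have redundant: False if "D \<in> G" "D1 \<in> G" "D2 \<in> G" "D1 \<noteq> D" "D2 \<noteq> D" "D \<subseteq> D1 \<union> D2" for D D1 D2
    proof -
      have "\<Union>G \<subseteq> \<Union>(G - {D})"
      proof
        fix y assume "y \<in> \<Union>G"
        then obtain E where "E \<in> G" "y \<in> E" by blast
        then show "y \<in> \<Union>(G - {D})" using that by (cases "E = D") auto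
      qed
      then have "\<Union>(G - {D}) = \<Union>G" by blast
      then have "?P (G - {D})" using G by auto
      then have "card G \<le> card (G - {D})" by (rule min)
      then show False using that(1) finG by (metis card_Diff1_less linorder_not_le)
    qed
    have mem: "A \<in> G" "B \<in> G" "C \<in> G" "x \<in> A" "x \<in> B" "x \<in> C"
      using T(1) unfolding ABC(1) by blast+
    then have "A \<in> F" "B \<in> F" "C \<in> F" using G by auto
    from three[OF this mem(4-6)] show False
    proof (elim disjE)
      assume "A \<subseteq> B \<union> C"
      then show False using mem(1-3) ABC(2-4) by (intro redundant[of A B C]) auto
    next
      assume "B \<subseteq> A \<union> C"
      then show False using mem(1-3) ABC(2-4) by (intro redundant[of B A C]) auto
    next
      assume "C \<subseteq> A \<union> B"
      then show False using mem(1-3) ABC(2-4) by (intro redundant[of C A B]) auto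
    qed
  qed
  with G show ?thesis by (intro that[of G]) auto
qed

section \<open>Arcs of the circle as images of real intervals\<close>

definition circle_arc :: "real \<Rightarrow> real \<Rightarrow> complex set" where
  "circle_arc a b = cis ` {a<..<b}"

lemma cis_eq_iff: "cis a = cis b \<longleftrightarrow> (\<exists>n::int. a = b + 2 * pi * n)"
  using sin_cos_eq_iff[of a b] by (auto simp: complex_eq_iff)

lemma cis_Arg_unit: "norm z = 1 \<Longrightarrow> cis (Arg z) = z"
  using complex_norm_eq_1_exp_eq[of z] by (simp add: cis_conv_exp)

text \<open>An angle is determined only modulo \<open>2 * pi\<close>. Translating the interval by a
  multiple of it lifts arcs through a common point to intervals around one common angle.\<close>

lemma arc_recentre:
  assumes "cis \<theta> \<in> circle_arc a b"
  obtains a' b' where "circle_arc a b = circle_arc a' b'" "a' < \<theta>" "\<theta> < b'"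
proof -
  obtain u where u: "a < u" "u < b" "cis \<theta> = cis u"
    using assms by (auto simp: circle_arc_def)
  then obtain k where k: "\<theta> = u + 2 * pi * of_int k"
    by (metis cis_eq_iff)
  have "circle_arc a b \<subseteq> circle_arc (a + c) (b + c)" if "c = 2 * pi * of_int k'" for a b c k'
    unfolding circle_arc_def
  proof (rule image_subsetI)
    fix t assume "t \<in> {a<..<b}"
    moreover have "cis t = cis (t + c)" unfolding that cis_eq_iff by (intro exI[of _ "-k'"]) simp
    ultimately show "cis t \<in> cis ` {a+c<..<b+c}" by auto
  qed
  from this[of "2 * pi * of_int k" k a b] this[of "- (2 * pi * of_int k)" "-k" "a + 2 * pi * of_int k" "b + 2 * pi * of_int k"]
  have "circle_arc a b = circle_arc (a + 2 * pi * of_int k) (b + 2 * pi * of_int k)" by auto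
  then show ?thesis using that u k by auto
qed

text \<open>Once lifted to intervals around a common angle, one that reaches farthest to the left
  and one that reaches farthest to the right together cover the remaining one.\<close>

lemma arcs_three:
  assumes "x \<in> circle_arc a1 b1" "x \<in> circle_arc a2 b2" "x \<in> circle_arc a3 b3"
  shows "circle_arc a1 b1 \<subseteq> circle_arc a2 b2 \<union> circle_arc a3 b3 \<or> circle_arc a2 b2 \<subseteq> circle_arc a1 b1 \<union> circle_arc a3 b3
    \<or> circle_arc a3 b3 \<subseteq> circle_arc a1 b1 \<union> circle_arc a2 b2"
proof -
  obtain \<theta> where x: "x = cis \<theta>" using assms(1) by (auto simp: circle_arc_def)
  obtain c1 d1 where 1: "circle_arc a1 b1 = circle_arc c1 d1" "c1 < \<theta>" "\<theta> < d1"
    using assms(1) x arc_recentre by blast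
  obtain c2 d2 where 2: "circle_arc a2 b2 = circle_arc c2 d2" "c2 < \<theta>" "\<theta> < d2"
    using assms(2) x arc_recentre by blast
  obtain c3 d3 where 3: "circle_arc a3 b3 = circle_arc c3 d3" "c3 < \<theta>" "\<theta> < d3"
    using assms(3) x arc_recentre by blast
  have un: "circle_arc c d \<subseteq> circle_arc c' d' \<union> circle_arc c'' d''"
    if "min c' c'' \<le> c" "d \<le> max d' d''" "c' < \<theta>" "\<theta> < d'" "c'' < \<theta>" "\<theta> < d''" for c d c' d' c'' d''
  proof -
    have "{c<..<d} \<subseteq> {c'<..<d'} \<union> {c''<..<d''}"
      using that by (auto simp: min_def max_def split: if_splits)
    then show ?thesis unfolding circle_arc_def image_Un[symmetric] by (rule image_mono)
  qed
  have "min c2 c3 \<le> c1 \<and> d1 \<le> max d2 d3 \<or> min c1 c3 \<le> c2 \<and> d2 \<le> max d1 d3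
      \<or> min c1 c2 \<le> c3 \<and> d3 \<le> max d1 d2"
    by linarith
  then show ?thesis
    unfolding 1(1) 2(1) 3(1)
    using un[of c2 c3 c1 d1 d2 d3] un[of c1 c3 c2 d2 d1 d3] un[of c1 c2 c3 d3 d1 d2] 1 2 3 by argo
qed

lemma dist_cis: "dist (cis t) (cis \<theta>) = 2 * \<bar>sin ((t - \<theta>) / 2)\<bar>"
proof -
  have "cis t - cis \<theta> = cis ((t + \<theta>) / 2) * (cis ((t - \<theta>) / 2) - cnj (cis ((t - \<theta>) / 2)))"
    by (simp add: cis_cnj algebra_simps cis_mult diff_divide_distrib add_divide_distrib)
  also have "cis ((t - \<theta>) / 2) - cnj (cis ((t - \<theta>) / 2)) = 2 * \<i> * sin ((t - \<theta>) / 2)"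
    by (simp add: complex_eq_iff)
  finally show ?thesis by (simp add: dist_norm norm_mult)
qed

lemma sphere_ball_arc:
  assumes "\<xi> \<in> sphere 0 1" "0 < s" "s < 2"
  obtains a b where "sphere 0 1 \<inter> ball \<xi> s = circle_arc a b"
proof -
  obtain \<theta> where \<xi>: "\<xi> = cis \<theta>"
    using assms(1) cis_Arg_unit[of \<xi>] by (metis dist_0_norm mem_sphere)
  \<comment> \<open>The angle subtended by a chord of length \<open>s\<close>. Since
    \<open>s < 2\<close> it stays below \<open>pi\<close>, and the sine of the half-angle is
    increasing on this range.\<close>
  define \<beta> where "\<beta> = 2 * arcsin (s / 2)"
  have \<beta>: "0 < \<beta>" "\<beta> < pi"
    using assms arcsin_less_arcsin[of 0 "s/2"] arcsin_less_arcsin[of "s/2" 1] by (auto simp: \<beta>_def)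
  have sin\<beta>: "sin (\<beta> / 2) = s / 2" using assms by (simp add: \<beta>_def)
  have *: "2 * \<bar>sin (u / 2)\<bar> < s \<longleftrightarrow> \<bar>u\<bar> < \<beta>" if "\<bar>u\<bar> \<le> pi" for u
  proof -
    have "\<bar>sin (u / 2)\<bar> = sin (\<bar>u\<bar> / 2)"
      using that sin_ge_zero[of "u/2"] sin_ge_zero[of "-u/2"] by (cases "u \<ge> 0") auto
    moreover have "sin (\<bar>u\<bar> / 2) < sin (\<beta> / 2) \<longleftrightarrow> \<bar>u\<bar> / 2 < \<beta> / 2"
      using that \<beta> by (intro sin_mono_less_eq) auto
    ultimately show ?thesis using sin\<beta> by (simp add: mult.commute)
  qed
  have "sphere 0 1 \<inter> ball \<xi> s = circle_arc (\<theta> - \<beta>) (\<theta> + \<beta>)"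
  proof safe
    fix x :: complex assume x: "x \<in> sphere 0 1" "x \<in> ball \<xi> s"
    define u where "u = Arg (x / \<xi>)"
    have "norm (x / \<xi>) = 1" using x \<xi> by (simp add: norm_divide)
    then have "cis u = x / \<xi>" unfolding u_def by (rule cis_Arg_unit)
    then have xu: "x = cis (\<theta> + u)" using \<xi> by (simp add: cis_mult[symmetric])
    have "\<bar>u\<bar> \<le> pi" unfolding u_def using Arg_bounded[of "x/\<xi>"] by auto
    moreover have "2 * \<bar>sin (u / 2)\<bar> < s"
      using x(2) by (simp add: xu \<xi> dist_commute dist_cis)
    ultimately have "\<bar>u\<bar> < \<beta>" using * by blast
    then show "x \<in> circle_arc (\<theta> - \<beta>) (\<theta> + \<beta>)" unfolding circle_arc_def xu by (intro imageI) auto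
  next
    fix x assume "x \<in> circle_arc (\<theta> - \<beta>) (\<theta> + \<beta>)"
    then obtain t where t: "x = cis t" "\<bar>t - \<theta>\<bar> < \<beta>" by (auto simp: circle_arc_def)
    then show "x \<in> ball \<xi> s" "x \<in> sphere 0 1"
      using *[of "t - \<theta>"] \<beta> dist_cis[of t \<theta>] by (simp_all add: \<xi> dist_commute)
  qed
  then show ?thesis using that by blast
qed

section \<open>Differentiation of measures on the circle\<close>

text \<open>Fubini for the indicator of the region below the graph of \<open>k\<close>. Only levels
  \<open>y > 0\<close> count, because \<open>ennreal\<close> sends negative values to 0.\<close>

lemma nn_integral_layer_cake:
  assumes "sigma_finite_measure M" and [measurable]: "k \<in> borel_measurable M"
  shows "(\<integral>\<^sup>+x. ennreal (k x) \<partial>M) = (\<integral>\<^sup>+y. indicator {0<..} y * emeasure M {x\<in>space M. y < k x} \<partial>lborel)"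
proof -
  interpret sigma_finite_measure M by fact
  interpret pair_sigma_finite M "lborel :: real measure" ..
  define f :: "'a \<Rightarrow> real \<Rightarrow> ennreal" where "f x y = (if 0 < y \<and> y < k x then 1 else 0)" for x y
  have [measurable]: "case_prod f \<in> borel_measurable (M \<Otimes>\<^sub>M lborel)"
    unfolding f_def by measurable
  have "(\<integral>\<^sup>+x. ennreal (k x) \<partial>M) = (\<integral>\<^sup>+x. (\<integral>\<^sup>+y. f x y \<partial>lborel) \<partial>M)"
  proof (rule nn_integral_cong)
    fix x
    have "f x = indicator {0<..<k x}" by (auto simp: f_def fun_eq_iff indicator_def)
    then show "ennreal (k x) = (\<integral>\<^sup>+y. f x y \<partial>lborel)"
      by (cases "0 \<le> k x") (auto simp: ennreal_neg)
  qed
  also have "\<dots> = (\<integral>\<^sup>+y. (\<integral>\<^sup>+x. f x y \<partial>M) \<partial>lborel)"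
    by (rule Fubini'[symmetric]) measurable
  also have "\<dots> = (\<integral>\<^sup>+y. indicator {0<..} y * emeasure M {x\<in>space M. y < k x} \<partial>lborel)"
  proof (rule nn_integral_cong)
    fix y :: real
    have "(\<integral>\<^sup>+x. f x y \<partial>M) = (\<integral>\<^sup>+x. indicator {0<..} y * indicator {x\<in>space M. y < k x} x \<partial>M)"
      by (intro nn_integral_cong) (auto simp: f_def indicator_def)
    also have "\<dots> = indicator {0<..} y * emeasure M {x\<in>space M. y < k x}"
      by (subst nn_integral_cmult_indicator) auto
    finally show "(\<integral>\<^sup>+x. f x y \<partial>M) = indicator {0<..} y * emeasure M {x\<in>space M. y < k x}" .
  qed
  finally show ?thesis .
qed

text \<open>The layer-cake formula turns a comparison of measures on superlevel sets into a
  comparison of integrals. For functions that decrease with the distance to a point these sets are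
  balls.\<close>

lemma nn_integral_le_superlevel:
  assumes "finite_measure \<nu>" "finite_measure \<mu>" "sets \<nu> = sets \<mu>" "k \<in> borel_measurable \<mu>"
    and le: "\<And>y. 0 < y \<Longrightarrow> emeasure \<nu> {x\<in>space \<mu>. y < k x} \<le> ennreal c * emeasure \<mu> {x\<in>space \<mu>. y < k x}"
  shows "(\<integral>\<^sup>+x. ennreal (k x) \<partial>\<nu>) \<le> ennreal c * (\<integral>\<^sup>+x. ennreal (k x) \<partial>\<mu>)"
proof -
  interpret \<mu>: finite_measure \<mu> by fact
  interpret \<nu>: finite_measure \<nu> by fact
  \<comment> \<open>Absorbing \<open>c\<close> into the measure reduces the claim to a pointwise
    comparison of the two layer-cake integrands.\<close>
  let ?\<mu> = "scale_measure (ennreal c) \<mu>"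
  have sp: "space \<nu> = space \<mu>" using assms(3) by (rule sets_eq_imp_space_eq)
  have k\<nu>: "k \<in> borel_measurable \<nu>" using assms(3,4) by (simp cong: measurable_cong_sets)
  have fin: "finite_measure ?\<mu>"
    by (rule finite_measureI) (simp add: ennreal_mult_eq_top_iff space_scale_measure)
  have "(\<integral>\<^sup>+x. ennreal (k x) \<partial>\<nu>) \<le> (\<integral>\<^sup>+x. ennreal (k x) \<partial>?\<mu>)"
    using le assms(4)
    by (subst (1 2) nn_integral_layer_cake)
      (auto simp: k\<nu> sp space_scale_measure indicator_def \<nu>.sigma_finite_measure_axioms
        finite_measure.axioms(1)[OF fin] intro!: nn_integral_mono cong: measurable_cong_sets)
  also have "\<dots> = ennreal c * (\<integral>\<^sup>+x. ennreal (k x) \<partial>\<mu>)"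
    using assms(4) by (simp add: nn_integral_scale_measure)
  finally show ?thesis .
qed

text \<open>By inner regularity it is enough to estimate compact sets \<open>K\<close>. Finitely
  many balls cover \<open>K\<close>, their traces on the circle are arcs, and a minimal subcover
  meets each point at most twice; this is the source of the factor 2.\<close>

lemma covering_estimate:
  fixes \<mu> \<nu> :: "complex measure"
  assumes "finite_measure \<mu>" "finite_measure \<nu>"
    and sets\<mu>: "sets \<mu> = sets circle_borel" and sets\<nu>: "sets \<nu> = sets circle_borel"
    and "open U"
    and \<B>: "\<And>B. B \<in> \<B> \<Longrightarrow> \<exists>\<xi> s. B = ball \<xi> s \<and> \<xi> \<in> sphere 0 1 \<and> 0 < s \<and> s < 2 \<and> B \<subseteq> U
        \<and> ennreal c * emeasure \<mu> (sphere 0 1 \<inter> B) \<le> emeasure \<nu> (sphere 0 1 \<inter> B)"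
  shows "ennreal c * emeasure \<mu> (sphere 0 1 \<inter> \<Union>\<B>) \<le> 2 * emeasure \<nu> (sphere 0 1 \<inter> U)"
proof -
  interpret \<mu>: finite_measure \<mu> by fact
  let ?S = "sphere 0 1 :: complex set"
  have sp: "space \<mu> = ?S" "space \<nu> = ?S"
    using sets_eq_imp_space_eq[OF sets\<mu>] sets_eq_imp_space_eq[OF sets\<nu>] by simp_all
  have inS: "?S \<inter> X \<in> sets circle_borel" if "X \<in> sets borel" for X
    using that by (rule sphere_Int_circle_borel)
  have opB: "open B" if "B \<in> \<B>" for B using \<B>[OF that] by auto
  have idm: "(\<lambda>x. x) \<in> measurable \<mu> borel"
    using sets\<mu> by (simp add: circle_borel_def measurable_restrict_space1 cong: measurable_cong_sets)
  \<comment> \<open>Regularity is applied on the whole plane, so the measure is pushed forward from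
    the circle.\<close>
  define \<mu>' where "\<mu>' = distr \<mu> borel (\<lambda>x. x)"
  have em: "emeasure \<mu>' X = emeasure \<mu> (?S \<inter> X)" if "X \<in> sets borel" for X
    unfolding \<mu>'_def using idm that by (subst emeasure_distr) (auto simp: sp Int_commute)
  have E: "?S \<inter> \<Union>\<B> \<in> sets borel" 
    using inS[OF borel_open[OF open_Union[of \<B>]]] opB sets_circle_borel_iff by blast
  have "emeasure \<mu>' (?S \<inter> \<Union>\<B>) = (SUP K \<in> {K. K \<subseteq> ?S \<inter> \<Union>\<B> \<and> compact K}. emeasure \<mu>' K)"
    using E by (intro inner_regular) (auto simp: \<mu>'_def emeasure_distr idm)
  moreover have "ennreal c * emeasure \<mu>' K \<le> 2 * emeasure \<nu> (?S \<inter> U)"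
    if K: "K \<subseteq> ?S \<inter> \<Union>\<B>" "compact K" for K
  proof -
    obtain \<F> where \<F>: "\<F> \<subseteq> \<B>" "finite \<F>" "K \<subseteq> \<Union>\<F>"
    proof (rule compactE[OF K(2), of \<B>])
      show "K \<subseteq> \<Union>\<B>" using K(1) by simp
    qed (rule opB)
    define F where "F = (\<lambda>B. ?S \<inter> B) ` \<F>"
    have "finite F" using \<F> by (simp add: F_def)
    have arcs: "\<exists>a b. A = circle_arc a b" if A: "A \<in> F" for A
    proof -
      obtain B where "B \<in> \<B>" and A: "A = ?S \<inter> B" using A \<F>(1) by (auto simp: F_def)
      then obtain \<xi> s where "B = ball \<xi> s" "\<xi> \<in> ?S" "0 < s" "s < 2" using \<B> by blast
      then show ?thesis unfolding A using sphere_ball_arc[of \<xi> s] by blast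
    qed
    have three: "A \<subseteq> B \<union> C \<or> B \<subseteq> A \<union> C \<or> C \<subseteq> A \<union> B"
      if mem: "A \<in> F" "B \<in> F" "C \<in> F" and x: "x \<in> A" "x \<in> B" "x \<in> C" for A B C x
    proof -
      obtain a1 b1 a2 b2 a3 b3 where "A = circle_arc a1 b1" "B = circle_arc a2 b2" "C = circle_arc a3 b3"
        using arcs mem by meson
      then show ?thesis using x arcs_three by simp
    qed
    obtain G where G: "G \<subseteq> F" "\<Union>G = \<Union>F" "\<And>x. card {A\<in>G. x \<in> A} \<le> 2"
    proof (rule minimal_subcover_overlap[OF \<open>finite F\<close>])
      show "A \<subseteq> B \<union> C \<or> B \<subseteq> A \<union> C \<or> C \<subseteq> A \<union> B"
        if "A \<in> F" "B \<in> F" "C \<in> F" "x \<in> A" "x \<in> B" "x \<in> C" for A B C x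
        using that by (rule three)
    qed (rule that)
    have finG: "finite G" using G(1) \<open>finite F\<close> finite_subset by blast
    have GS: "A \<in> sets circle_borel" "A \<subseteq> U" "ennreal c * emeasure \<mu> A \<le> emeasure \<nu> A" if "A \<in> G" for A
    proof -
      have "A \<in> F" using that G(1) by blast
      then obtain B where "B \<in> \<F>" "A = ?S \<inter> B" unfolding F_def by blast
      then have B: "B \<in> \<B>" "A = ?S \<inter> B" using \<F>(1) by auto
      then show "A \<in> sets circle_borel" using opB by (simp add: inS)
      show "A \<subseteq> U" "ennreal c * emeasure \<mu> A \<le> emeasure \<nu> A" using B \<B>[OF B(1)] by auto
    qed
    have "emeasure \<mu>' K = emeasure \<mu> (?S \<inter> K)"
      using K by (intro em) (simp add: borel_compact)
    also have "\<dots> \<le> emeasure \<mu> (\<Union>G)"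
      using K \<F> G(2) GS(1) finG by (intro emeasure_mono sets.finite_Union) (auto simp: F_def sets\<mu>)
    also have "\<dots> \<le> (\<Sum>A\<in>G. emeasure \<mu> A)"
      using emeasure_subadditive_finite[of G id \<mu>] GS(1) finG sets\<mu> by auto
    finally have "ennreal c * emeasure \<mu>' K \<le> ennreal c * (\<Sum>A\<in>G. emeasure \<mu> A)"
      by (rule mult_left_mono) simp
    also have "\<dots> \<le> (\<Sum>A\<in>G. emeasure \<nu> A)"
      unfolding sum_distrib_left by (intro sum_mono GS(3))
    also have "\<dots> = (\<Sum>A\<in>G. \<integral>\<^sup>+x. indicator A x \<partial>\<nu>)"
      using GS(1) sets\<nu> by (intro sum.cong) auto
    also have "\<dots> = (\<integral>\<^sup>+x. (\<Sum>A\<in>G. indicator A x) \<partial>\<nu>)"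
      using GS(1) sets\<nu> by (intro nn_integral_sum[symmetric]) auto
    \<comment> \<open>The overlap count: at most two members of \<open>G\<close> contain a given
      point, and all of them lie in \<open>U\<close>.\<close>
    also have "\<dots> \<le> (\<integral>\<^sup>+x. 2 * indicator (?S \<inter> U) x \<partial>\<nu>)"
    proof (rule nn_integral_mono)
      fix x assume x: "x \<in> space \<nu>"
      have "(\<Sum>A\<in>G. indicator A x :: ennreal) = of_nat (card {A\<in>G. x \<in> A})"
        using finG by (simp add: indicator_def sum.If_cases Int_def)
      also have "\<dots> \<le> 2 * indicator (?S \<inter> U) x"
      proof (cases "x \<in> U")
        case True
        then show ?thesis using x sp of_nat_mono[OF G(3)[of x], where 'a=ennreal] by (simp add: indicator_def)
      next
        case False
        then have "{A\<in>G. x \<in> A} = {}" using GS(2) by blast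
        then show ?thesis by (simp only: card.empty of_nat_0 zero_le)
      qed
      finally show "(\<Sum>A\<in>G. indicator A x :: ennreal) \<le> 2 * indicator (?S \<inter> U) x" .
    qed
    also have "\<dots> = 2 * emeasure \<nu> (?S \<inter> U)"
      using inS \<open>open U\<close> sets\<nu> by (subst nn_integral_cmult_indicator) auto
    finally show ?thesis .
  qed
  ultimately have "ennreal c * emeasure \<mu>' (?S \<inter> \<Union>\<B>) \<le> 2 * emeasure \<nu> (?S \<inter> U)"
    by (simp add: SUP_mult_left_ennreal) (rule SUP_least, auto)
  then show ?thesis using em[OF E] by (simp add: Int_assoc[symmetric])
qed

text \<open>For fixed \<open>c\<close>, outer regularity encloses \<open>A\<close> in open sets of
  small \<open>\<nu>\<close>-measure. A point of \<open>A\<close> where the estimate fails at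
  arbitrarily small radii is the centre of a bad ball inside each of them, and
  \<open>covering_estimate\<close> bounds the \<open>\<mu>\<close>-measure of the union of such
  balls.\<close>

lemma AE_ball_ratio_tendsto_0:
  fixes \<mu> \<nu> :: "complex measure"
  assumes "finite_measure \<mu>" "finite_measure \<nu>"
    and sets\<mu>: "sets \<mu> = sets circle_borel" and sets\<nu>: "sets \<nu> = sets circle_borel"
    and A: "A \<in> sets circle_borel" "emeasure \<nu> A = 0"
  shows "AE \<xi> in \<mu>. \<xi> \<in> A \<longrightarrow> (\<forall>c>0. \<exists>\<delta>>0. \<forall>s. 0 < s \<and> s < \<delta> \<longrightarrow>
    emeasure \<nu> (sphere 0 1 \<inter> ball \<xi> s) \<le> ennreal c * emeasure \<mu> (sphere 0 1 \<inter> ball \<xi> s))"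
proof -
  interpret \<nu>: finite_measure \<nu> by fact
  let ?S = "sphere 0 1 :: complex set"
  have sp: "space \<mu> = ?S" "space \<nu> = ?S"
    using sets_eq_imp_space_eq[OF sets\<mu>] sets_eq_imp_space_eq[OF sets\<nu>] by simp_all
  have "AE \<xi> in \<mu>. \<xi> \<in> A \<longrightarrow> (\<exists>\<delta>>0. \<forall>s. 0 < s \<and> s < \<delta> \<longrightarrow>
    emeasure \<nu> (?S \<inter> ball \<xi> s) \<le> ennreal c * emeasure \<mu> (?S \<inter> ball \<xi> s))" if "c > 0" for c
  proof -
    have "\<exists>U. open U \<and> A \<subseteq> U \<and> emeasure \<nu> (?S \<inter> U) < ennreal (1 / Suc n)" for n
    proof -
      have idm: "(\<lambda>x. x) \<in> measurable \<nu> borel"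
        using sets\<nu> by (simp add: circle_borel_def measurable_restrict_space1 cong: measurable_cong_sets)
      define \<nu>' where "\<nu>' = distr \<nu> borel (\<lambda>x. x)"
      have em: "emeasure \<nu>' X = emeasure \<nu> (?S \<inter> X)" if "X \<in> sets borel" for X
        unfolding \<nu>'_def using idm that by (subst emeasure_distr) (auto simp: sp Int_commute)
      have Ab: "A \<in> sets borel" "?S \<inter> A = A" using A(1) by (auto simp: sets_circle_borel_iff)
      have "(INF U \<in> {U. A \<subseteq> U \<and> open U}. emeasure \<nu>' U) = emeasure \<nu>' A"
        using Ab by (intro outer_regular[symmetric]) (auto simp: \<nu>'_def emeasure_distr idm)
      also have "\<dots> < ennreal (1 / Suc n)" using em Ab A(2) by simp
      finally show ?thesis unfolding INF_less_iff using em by force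
    qed
    then obtain U where U: "\<And>n. open (U n)" "\<And>n. A \<subseteq> U n" "\<And>n. emeasure \<nu> (?S \<inter> U n) < ennreal (1 / Suc n)"
      by metis
    define \<B> where "\<B> n = {ball \<xi> s | \<xi> s. \<xi> \<in> ?S \<and> 0 < s \<and> s < 2 \<and> ball \<xi> s \<subseteq> U n \<and>
      ennreal c * emeasure \<mu> (?S \<inter> ball \<xi> s) \<le> emeasure \<nu> (?S \<inter> ball \<xi> s)}" for n
    \<comment> \<open>Instead of the set of failing points, the measurable set \<open>N\<close>
      containing it, a countable intersection of relatively open sets, is shown to be null.\<close>
    define N where "N = (\<Inter>n. ?S \<inter> \<Union>(\<B> n))"
    have sN: "?S \<inter> \<Union>(\<B> n) \<in> sets \<mu>" for n
      unfolding sets\<mu> by (intro sphere_Int_circle_borel borel_open open_Union) (auto simp: \<B>_def)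
    have bd: "ennreal c * emeasure \<mu> N \<le> ennreal (2 * (1 / Suc n))" for n
    proof -
      have "ennreal c * emeasure \<mu> N \<le> ennreal c * emeasure \<mu> (?S \<inter> \<Union>(\<B> n))"
        using sN by (intro mult_left_mono emeasure_mono) (auto simp: N_def)
      also have "\<dots> \<le> 2 * emeasure \<nu> (?S \<inter> U n)"
        by (rule covering_estimate[OF assms(1-4) U(1)]) (auto simp: \<B>_def)
      also have "\<dots> \<le> 2 * ennreal (1 / Suc n)" using U(3)[of n] by (intro mult_left_mono) auto
      also have "\<dots> = ennreal (2 * (1 / Suc n))" by (subst ennreal_mult) auto
      finally show ?thesis .
    qed
    have "(\<lambda>n. ennreal (2 * (1 / Suc n))) \<longlonglongrightarrow> ennreal (2 * 0)"
      by (intro tendsto_ennrealI tendsto_mult tendsto_const lim_1_over_n[THEN LIMSEQ_Suc])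
    then have "ennreal c * emeasure \<mu> N \<le> ennreal (2 * 0)"
      by (rule LIMSEQ_le_const) (use bd in blast)
    then have "emeasure \<mu> N = 0" using that by simp
    moreover have "N \<in> sets \<mu>" unfolding N_def using sN by (intro sets.countable_INT) auto
    ultimately have "N \<in> null_sets \<mu>" by (simp add: null_sets_def)
    then have "AE \<xi> in \<mu>. \<xi> \<notin> N" by (rule AE_not_in)
    then show ?thesis
    proof (rule AE_mp, intro AE_I2 impI)
      fix \<xi> assume \<xi>: "\<xi> \<in> space \<mu>" "\<xi> \<notin> N" "\<xi> \<in> A"
      then obtain n where n: "\<xi> \<notin> \<Union>(\<B> n)" using sp by (auto simp: N_def)
      have "\<xi> \<in> U n" using U(2) \<xi> by blast
      then obtain e where e: "e > 0" "ball \<xi> e \<subseteq> U n" using U(1) openE by blast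
      have "emeasure \<nu> (?S \<inter> ball \<xi> s) \<le> ennreal c * emeasure \<mu> (?S \<inter> ball \<xi> s)"
        if "0 < s" "s < min e 2" for s
      proof (rule ccontr)
        assume "\<not> ?thesis"
        then have "ball \<xi> s \<in> \<B> n"
          using that e \<xi>(1) sp unfolding \<B>_def by fastforce
        then show False using n that by auto
      qed
      then show "\<exists>\<delta>>0. \<forall>s. 0 < s \<and> s < \<delta> \<longrightarrow>
        emeasure \<nu> (?S \<inter> ball \<xi> s) \<le> ennreal c * emeasure \<mu> (?S \<inter> ball \<xi> s)"
        using e(1) by (intro exI[of _ "min e 2"]) auto
    qed
  qed
  \<comment> \<open>The constants \<open>1 / Suc n\<close> suffice, so that only countably many null
    sets are united.\<close>
  then have "AE \<xi> in \<mu>. \<forall>n. \<xi> \<in> A \<longrightarrow> (\<exists>\<delta>>0. \<forall>s. 0 < s \<and> s < \<delta> \<longrightarrow>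
    emeasure \<nu> (?S \<inter> ball \<xi> s) \<le> ennreal (1 / Suc n) * emeasure \<mu> (?S \<inter> ball \<xi> s))"
    unfolding AE_all_countable by simp
  then show ?thesis
  proof (rule AE_mp, intro AE_I2 impI allI)
    fix \<xi> and c :: real
    assume *: "\<forall>n. \<xi> \<in> A \<longrightarrow> (\<exists>\<delta>>0. \<forall>s. 0 < s \<and> s < \<delta> \<longrightarrow>
      emeasure \<nu> (?S \<inter> ball \<xi> s) \<le> ennreal (1 / Suc n) * emeasure \<mu> (?S \<inter> ball \<xi> s))"
      and "\<xi> \<in> A" "c > 0"
    obtain n where "1 / Suc n < c" using \<open>c > 0\<close> nat_approx_posE by blast
    then have "ennreal (1 / Suc n) * x \<le> ennreal c * x" for x
      by (intro mult_right_mono ennreal_leI) auto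
    then show "\<exists>\<delta>>0. \<forall>s. 0 < s \<and> s < \<delta> \<longrightarrow>
      emeasure \<nu> (?S \<inter> ball \<xi> s) \<le> ennreal c * emeasure \<mu> (?S \<inter> ball \<xi> s)"
      using * \<open>\<xi> \<in> A\<close> by (meson order_trans)
  qed
qed

section \<open>Arc length of small balls on the circle\<close>

lemma finite_measure_circle_lebesgue: "finite_measure circle_lebesgue"
  and sets_circle_lebesgue: "sets circle_lebesgue = sets circle_borel"
  and emeasure_circle_lebesgue_ball: "\<lbrakk>\<xi> \<in> sphere 0 1; 0 < s; s \<le> pi\<rbrakk> \<Longrightarrow>
    ennreal s \<le> emeasure circle_lebesgue (sphere 0 1 \<inter> ball \<xi> s)"
proof -
  let ?R = "restrict_space lborel {0..<2 * pi}"
  have m: "cis \<in> measurable ?R circle_borel"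
    unfolding circle_borel_def
    by (intro measurable_restrict_space2 measurable_restrict_space1)
       (auto intro!: borel_measurable_continuous_onI continuous_intros)
  have "finite_measure ?R"
    by (rule finite_measureI) (simp add: space_restrict_space emeasure_restrict_space)
  then show "finite_measure circle_lebesgue"
    unfolding circle_lebesgue_def using m by (rule finite_measure.finite_measure_distr)
  show "sets circle_lebesgue = sets circle_borel" by (simp add: circle_lebesgue_def)
  assume \<xi>: "\<xi> \<in> sphere 0 1" and s: "0 < s" "s \<le> pi"
  obtain \<phi> where \<phi>: "0 \<le> \<phi>" "\<phi> < 2 * pi" "\<xi> = cis \<phi>"
  proof
    show "0 \<le> Arg2pi \<xi>" "Arg2pi \<xi> < 2 * pi" by (auto simp: Arg2pi_ge_0 Arg2pi_lt_2pi)
    show "\<xi> = cis (Arg2pi \<xi>)" using \<xi> complex_norm_eq_1_exp[of \<xi>] by (simp add: cis_conv_exp)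
  qed
  \<comment> \<open>An arc on one side of \<open>\<xi>\<close> is enough, chosen so that the
    parameter does not wrap around. If it would pass \<open>2 * pi\<close>, then
    \<open>s \<le> pi\<close> leaves room on the other side.\<close>
  define a where "a = (if \<phi> + s \<le> 2 * pi then \<phi> else \<phi> - s)"
  have sub: "{a<..<a+s} \<subseteq> {t\<in>{0..<2*pi}. cis t \<in> sphere 0 1 \<inter> ball \<xi> s}"
  proof
    fix t assume t: "t \<in> {a<..<a+s}"
    then have "\<bar>\<phi> - t\<bar> < s" by (auto simp: a_def split: if_splits)
    moreover have "dist \<xi> (cis t) \<le> \<bar>\<phi> - t\<bar>"
      using abs_sin_x_le_abs_x[of "(\<phi> - t) / 2"] by (simp add: \<phi>(3) dist_cis)
    moreover have "0 \<le> t" "t < 2 * pi" using t \<phi> s by (auto simp: a_def split: if_splits)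
    ultimately show "t \<in> {t\<in>{0..<2*pi}. cis t \<in> sphere 0 1 \<inter> ball \<xi> s}" by auto
  qed
  have msr: "{t\<in>{0..<2*pi}. cis t \<in> sphere 0 1 \<inter> ball \<xi> s} \<in> sets ?R"
    using measurable_sets[OF m sphere_Int_circle_borel[of "ball \<xi> s"]]
    by (simp add: space_restrict_space vimage_def Int_def conj_commute)
  have "ennreal s = emeasure lborel {a<..<a+s}" using s by simp
  also have "\<dots> \<le> emeasure lborel {t\<in>{0..<2*pi}. cis t \<in> sphere 0 1 \<inter> ball \<xi> s}"
    using sub msr by (intro emeasure_mono) (auto simp: sets_restrict_space_iff)
  also have "\<dots> = emeasure circle_lebesgue (sphere 0 1 \<inter> ball \<xi> s)"
    unfolding circle_lebesgue_def
    by (subst emeasure_distr[OF m sphere_Int_circle_borel], simp)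
       (subst emeasure_restrict_space, auto simp: space_restrict_space intro!: arg_cong[where f="emeasure lborel"])
  finally show "ennreal s \<le> emeasure circle_lebesgue (sphere 0 1 \<inter> ball \<xi> s)" .
qed

section \<open>Poisson integrals of matrix-valued measures\<close>

text \<open>\<open>measure_of\<close> takes the prescribed values once countable additivity is
  known; nonnegativity turns the real series into an \<open>ennreal\<close> series with the same
  sum.\<close>

lemma emeasure_measure_of_real_sums:
  fixes h :: "'a set \<Rightarrow> real"
  assumes "\<And>A. A \<in> sets N \<Longrightarrow> 0 \<le> h A" "h {} = 0"
    and "\<And>F :: nat \<Rightarrow> 'a set. range F \<subseteq> sets N \<Longrightarrow> disjoint_family F \<Longrightarrow> (\<lambda>k. h (F k)) sums h (\<Union>k. F k)"
    and A: "A \<in> sets N"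
  shows "emeasure (measure_of (space N) (sets N) (\<lambda>A. ennreal (h A))) A = ennreal (h A)"
proof (rule emeasure_measure_of_sigma[OF sets.sigma_algebra_axioms _ _ A])
  show "positive (sets N) (\<lambda>A. ennreal (h A))"
    using assms(2) by (simp add: positive_def)
  show "countably_additive (sets N) (\<lambda>A. ennreal (h A))"
    unfolding countably_additive_def
  proof safe
    fix F :: "nat \<Rightarrow> 'a set" assume F: "range F \<subseteq> sets N" "disjoint_family F"
    have "(\<Sum>i. ennreal (h (F i))) = ennreal (\<Sum>i. h (F i))"
      using assms(1) F assms(3)[OF F] by (intro suminf_ennreal2) (auto simp: sums_iff)
    then show "(\<Sum>i. ennreal (h (F i))) = ennreal (h (\<Union> (range F)))"
      using assms(3)[OF F] by (simp add: sums_iff)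
  qed
qed

lemma psd_measure_sums:
  assumes "psd_measure M" "range F \<subseteq> sets circle_borel" "disjoint_family F"
  shows "(\<lambda>k::nat. M (F k)) sums M (\<Union>k. F k)"
  using assms unfolding psd_measure_def by blast

text \<open>The constant sequence of empty sets is disjoint, and a convergent constant series has
  terms 0.\<close>

lemma psd_measure_empty: "psd_measure M \<Longrightarrow> M {} = 0"
proof -
  assume M: "psd_measure M"
  have "(\<lambda>k::nat. M {}) sums M (\<Union>k::nat. {})"
    using psd_measure_sums[OF M, of "\<lambda>_. {}"] by (simp add: disjoint_family_on_def)
  then have "(\<lambda>k::nat. M {}) \<longlonglongrightarrow> 0" by (rule summable_LIMSEQ_zero[OF sums_summable])
  then show ?thesis by (simp add: LIMSEQ_const_iff)
qed

lemma cdot_axis: "cdot (A *v axis i 1) (axis i 1) = A $ i $ i"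
proof -
  have "cdot (column i A) (axis i 1) = (\<Sum>j\<in>UNIV. if j = i then A $ j $ i else 0)"
    unfolding cdot_def by (intro sum.cong) (auto simp: axis_def column_def)
  moreover have "A *v axis i 1 = column i A"
    by (simp add: vec_eq_iff column_def matrix_vector_mult_def axis_def if_distrib[of "\<lambda>x. _ * x"] cong: if_cong)
  ultimately show ?thesis by simp
qed

lemma psd_trace_nonneg: "psd A \<Longrightarrow> 0 \<le> Re (trace A)"
  unfolding trace_def Re_sum psd_def by (intro sum_nonneg) (metis cdot_axis)

lemma bounded_linear_Re_trace: "bounded_linear (\<lambda>A::complex^'n^'n. Re (trace A))"
proof -
  have "linear (\<lambda>A::complex^'n^'n. Re (trace A))"
    by (rule linearI) (simp_all add: trace_def sum.distrib sum_distrib_left)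
  then show ?thesis by (simp add: linear_conv_bounded_linear)
qed

text \<open>Both set functions have the form \<open>T (M A)\<close> with \<open>T\<close> bounded,
  linear and nonnegative on semidefinite matrices, so they inherit countable additivity from
  \<open>M\<close>.\<close>

lemma
  fixes M :: "complex set \<Rightarrow> complex^'n^'n"
  assumes M: "psd_measure M"
  shows emeasure_trace_measure:
      "A \<in> sets circle_borel \<Longrightarrow> emeasure (trace_measure M) A = ennreal (Re (trace (M A)))"
    and emeasure_form_measure:
      "A \<in> sets circle_borel \<Longrightarrow> emeasure (form_measure M v) A = ennreal (Re (cdot (M A *v v) v))"
proof -
  have *: "A \<in> sets circle_borel \<Longrightarrow>
      emeasure (measure_of (space circle_borel) (sets circle_borel) (\<lambda>A. ennreal (T (M A)))) A = ennreal (T (M A))"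
    if "bounded_linear T" "\<And>A. psd A \<Longrightarrow> 0 \<le> T A" for T :: "complex^'n^'n \<Rightarrow> real" and A
  proof (rule emeasure_measure_of_real_sums)
    show "0 \<le> T (M A)" if "A \<in> sets circle_borel" for A
      using M that \<open>\<And>A. psd A \<Longrightarrow> 0 \<le> T A\<close> unfolding psd_measure_def by blast
    show "T (M {}) = 0"
      using that(1) by (simp add: psd_measure_empty[OF M] linear_0 bounded_linear.linear)
    show "(\<lambda>k. T (M (F k))) sums T (M (\<Union>k. F k))"
      if "range F \<subseteq> sets circle_borel" "disjoint_family F" for F :: "nat \<Rightarrow> complex set"
      by (rule bounded_linear.sums[OF \<open>bounded_linear T\<close> psd_measure_sums[OF M that]])
  qed
  show "A \<in> sets circle_borel \<Longrightarrow> emeasure (trace_measure M) A = ennreal (Re (trace (M A)))"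
    unfolding trace_measure_def by (rule *[OF bounded_linear_Re_trace psd_trace_nonneg])
  show "A \<in> sets circle_borel \<Longrightarrow> emeasure (form_measure M v) A = ennreal (Re (cdot (M A *v v) v))"
    unfolding form_measure_def
    by (rule *[OF bounded_linear_compose[OF bounded_linear_Re bounded_linear_cdot_matrix]])
       (auto simp: psd_def)
qed

lemma sets_trace_measure [simp]: "sets (trace_measure M) = sets circle_borel"
  and space_trace_measure [simp]: "space (trace_measure M) = sphere 0 1"
  and sets_form_measure [simp]: "sets (form_measure M v) = sets circle_borel"
  unfolding trace_measure_def form_measure_def
  by (rule sets.sets_measure_of_eq, subst sets.space_measure_of_eq, rule space_circle_borel, rule sets.sets_measure_of_eq)

lemma finite_trace_measure: "psd_measure M \<Longrightarrow> finite_measure (trace_measure M)"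
  using emeasure_trace_measure[of M "sphere 0 1"] sets.top[of circle_borel]
  by (intro finite_measureI) simp

text \<open>The quadratic form at \<open>v\<close> is bounded linear in the matrix and passes
  through the integral of \<open>W\<close>. This moves the weak matrix integral, which is defined by
  form measures, to the trace measure.\<close>

lemma form_measure_eq_density:
  assumes M: "psd_measure M" and W: "trace_density M W"
  shows "form_measure M v = density (trace_measure M) (\<lambda>x. ennreal (Re (cdot (W x *v v) v)))"
proof (rule measure_eqI)
  let ?\<mu> = "trace_measure M"
  let ?T = "\<lambda>A. Re (cdot (A *v v) v)"
  have T: "bounded_linear ?T"
    by (rule bounded_linear_compose[OF bounded_linear_Re bounded_linear_cdot_matrix])
  have Wm: "W \<in> borel_measurable ?\<mu>" and Wi: "integrable ?\<mu> W"
    and Wp: "AE x in ?\<mu>. psd (W x)"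
    and WM: "\<And>A. A \<in> sets circle_borel \<Longrightarrow> M A = (LINT x:A|?\<mu>. W x)"
    using W unfolding trace_density_def by auto
  have Tm: "(\<lambda>x. ?T (W x)) \<in> borel_measurable ?\<mu>"
    using integrable_bounded_linear[OF T Wi] by simp
  fix A assume "A \<in> sets (form_measure M v)"
  then have A: "A \<in> sets circle_borel" "A \<in> sets ?\<mu>" by simp_all
  have ia: "integrable ?\<mu> (\<lambda>x. indicator A x *\<^sub>R W x)"
    by (rule integrable_mult_indicator[OF A(2) Wi])
  have "?T (M A) = (LINT x|?\<mu>. ?T (indicator A x *\<^sub>R W x))"
    unfolding WM[OF A(1)] set_lebesgue_integral_def
    by (rule integral_bounded_linear[OF T ia, symmetric])
  moreover have "(\<integral>\<^sup>+x. ennreal (?T (indicator A x *\<^sub>R W x)) \<partial>?\<mu>)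
      = ennreal (LINT x|?\<mu>. ?T (indicator A x *\<^sub>R W x))"
  proof (rule nn_integral_eq_integral)
    show "integrable ?\<mu> (\<lambda>x. ?T (indicator A x *\<^sub>R W x))"
      by (rule integrable_bounded_linear[OF T ia])
    show "AE x in ?\<mu>. 0 \<le> ?T (indicator A x *\<^sub>R W x)"
      using Wp by eventually_elim (auto simp: indicator_def psd_def cdot_def)
  qed
  moreover have "(\<integral>\<^sup>+x. ennreal (?T (indicator A x *\<^sub>R W x)) \<partial>?\<mu>)
      = (\<integral>\<^sup>+x. ennreal (?T (W x)) * indicator A x \<partial>?\<mu>)"
    by (intro nn_integral_cong) (auto simp: indicator_def cdot_def)
  ultimately show "emeasure (form_measure M v) A = emeasure (density ?\<mu> (\<lambda>x. ennreal (?T (W x)))) A"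
    using Tm A by (simp add: emeasure_form_measure[OF M A(1)] emeasure_density)
qed simp

section \<open>The Poisson kernel and Poisson integrals\<close>

definition poisson :: "complex \<Rightarrow> complex \<Rightarrow> real" where
  "poisson z \<zeta> = Re ((\<zeta> + z) / (\<zeta> - z))"

lemma poisson_eq:
  assumes "norm \<zeta> = 1"
  shows "poisson z \<zeta> = (1 - (cmod z)\<^sup>2) / (cmod (\<zeta> - z))\<^sup>2"
proof -
  have "Re ((\<zeta> + z) * cnj (\<zeta> - z)) = (cmod \<zeta>)\<^sup>2 - (cmod z)\<^sup>2"
    by (simp only: cmod_power2) (simp add: algebra_simps power2_eq_square)
  then show ?thesis
    using assms unfolding poisson_def by (subst complex_div_cnj) (simp del: complex_cnj_diff)
qed

lemma continuous_on_poisson: "z \<in> ball 0 1 \<Longrightarrow> continuous_on (sphere 0 1) (poisson z)"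
  unfolding poisson_def by (intro continuous_intros) (auto simp: dist_norm)

lemma integrable_bounded_scaleR:
  fixes f :: "'a \<Rightarrow> 'b::{banach, second_countable_topology}"
  assumes "integrable M f" "g \<in> borel_measurable M" "\<And>x. x \<in> space M \<Longrightarrow> \<bar>g x\<bar> \<le> c"
  shows "integrable M (\<lambda>x. g x *\<^sub>R f x)"
proof (rule Bochner_Integration.integrable_bound)
  show "integrable M (\<lambda>x. c *\<^sub>R f x)" using assms(1) by simp
  show "(\<lambda>x. g x *\<^sub>R f x) \<in> borel_measurable M" using assms(1,2) by measurable
  show "AE x in M. norm (g x *\<^sub>R f x) \<le> norm (c *\<^sub>R f x)"
    using assms(3) by (intro AE_I2) (force intro!: mult_right_mono)
qed

lemma integrable_poisson:
  fixes f :: "complex \<Rightarrow> 'b::{banach, second_countable_topology}"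
  assumes "sets \<mu> = sets circle_borel" "integrable \<mu> f" "z \<in> ball 0 1"
  shows "poisson z \<in> borel_measurable \<mu>" "integrable \<mu> (\<lambda>\<zeta>. poisson z \<zeta> *\<^sub>R f \<zeta>)"
proof -
  have sp: "space \<mu> = sphere 0 1" using sets_eq_imp_space_eq[OF assms(1)] by simp
  show m: "poisson z \<in> borel_measurable \<mu>"
    using borel_measurable_continuous_on_restrict[OF continuous_on_poisson[OF assms(3)]]
    by (simp add: circle_borel_def[symmetric] assms(1) cong: measurable_cong_sets)
  obtain c where "\<And>\<zeta>. \<zeta> \<in> sphere 0 1 \<Longrightarrow> \<bar>poisson z \<zeta>\<bar> \<le> c"
    using compact_imp_bounded[OF compact_continuous_image[OF continuous_on_poisson[OF assms(3)] compact_sphere]]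
    unfolding bounded_iff by (metis imageI real_norm_def)
  then show "integrable \<mu> (\<lambda>\<zeta>. poisson z \<zeta> *\<^sub>R f \<zeta>)"
    using assms(2) m by (intro integrable_bounded_scaleR) (auto simp: sp)
qed

text \<open>Banach-space values admit both \<open>f = W\<close> and \<open>f = 1\<close>, the matrix
  and scalar integrals whose quotient is studied below.\<close>

definition poisson_integral ::
  "complex measure \<Rightarrow> (complex \<Rightarrow> 'b::{banach, second_countable_topology}) \<Rightarrow> complex \<Rightarrow> 'b" where
  "poisson_integral \<mu> f z = (LINT \<zeta>|\<mu>. poisson z \<zeta> *\<^sub>R f \<zeta>)"

lemma poisson_nonneg: "\<lbrakk>norm \<zeta> = 1; norm z < 1\<rbrakk> \<Longrightarrow> 0 \<le> poisson z \<zeta>"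
  by (simp add: poisson_eq power_le_one)

text \<open>Adjoint and real part of the quadratic form are bounded linear over the reals, hence
  pass inside the integral, where the nonnegative kernel preserves semidefiniteness.\<close>

lemma psd_poisson_integral:
  assumes W: "trace_density M W" and z: "z \<in> ball 0 1"
  shows "psd (poisson_integral (trace_measure M) W z)"
proof -
  let ?\<mu> = "trace_measure M"
  have Wp: "AE x in ?\<mu>. psd (W x)" and Wi: "integrable ?\<mu> W" using W unfolding trace_density_def by auto
  note int = integrable_poisson(2)[OF sets_trace_measure Wi z]
  have T: "bounded_linear (\<lambda>A. Re (cdot (A *v v) v))" for v :: "complex^'a"
    by (rule bounded_linear_compose[OF bounded_linear_Re bounded_linear_cdot_matrix])
  show ?thesis
    unfolding psd_def
  proof safe
    have "cadj (poisson_integral ?\<mu> W z) = (LINT \<zeta>|?\<mu>. cadj (poisson z \<zeta> *\<^sub>R W \<zeta>))"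
      unfolding poisson_integral_def by (rule integral_bounded_linear[OF bounded_linear_cadj int, symmetric])
    also have "\<dots> = poisson_integral ?\<mu> W z"
      unfolding poisson_integral_def
    proof (rule integral_cong_AE)
      show "(\<lambda>\<zeta>. cadj (poisson z \<zeta> *\<^sub>R W \<zeta>)) \<in> borel_measurable ?\<mu>"
        using integrable_bounded_linear[OF bounded_linear_cadj int] by simp
      show "(\<lambda>\<zeta>. poisson z \<zeta> *\<^sub>R W \<zeta>) \<in> borel_measurable ?\<mu>" using int by simp
      show "AE \<zeta> in ?\<mu>. cadj (poisson z \<zeta> *\<^sub>R W \<zeta>) = poisson z \<zeta> *\<^sub>R W \<zeta>"
        using Wp by eventually_elim
          (simp add: psd_def linear_cmul[OF bounded_linear.linear[OF bounded_linear_cadj]])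
    qed
    finally show "cadj (poisson_integral ?\<mu> W z) = poisson_integral ?\<mu> W z" .
    fix v
    have "Re (cdot (poisson_integral ?\<mu> W z *v v) v) = (LINT \<zeta>|?\<mu>. Re (cdot ((poisson z \<zeta> *\<^sub>R W \<zeta>) *v v) v))"
      unfolding poisson_integral_def by (rule integral_bounded_linear[OF T int, symmetric])
    also have "\<dots> \<ge> 0"
    proof (rule integral_nonneg_AE)
      show "AE \<zeta> in ?\<mu>. 0 \<le> Re (cdot ((poisson z \<zeta> *\<^sub>R W \<zeta>) *v v) v)"
        using Wp AE_space
      proof eventually_elim
        case (elim \<zeta>)
        then have "0 \<le> poisson z \<zeta>" "0 \<le> Re (cdot (W \<zeta> *v v) v)"
          using z by (auto simp: psd_def intro!: poisson_nonneg)
        then show ?case by (simp add: scaleR_matrix_apply cdot_scaleR_left)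
      qed
    qed
    finally show "0 \<le> Re (cdot (poisson_integral ?\<mu> W z *v v) v)" .
  qed
qed

text \<open>Real parts turn the Herglotz kernel into the Poisson kernel, and the density of
  \<open>form_measure\<close> moves the integral to the trace measure. The later estimate uses
  nothing but the real part of the quadratic form.\<close>

lemma Re_cdot_matrix_integral:
  assumes M: "psd_measure M" and W: "trace_density M W" and z: "z \<in> ball 0 1"
    and J: "has_matrix_integral M (\<lambda>\<zeta>. (\<zeta> + z) / (\<zeta> - z)) J"
  shows "Re (cdot (J *v v) v) = Re (cdot (poisson_integral (trace_measure M) W z *v v) v)"
proof -
  let ?\<mu> = "trace_measure M"
  let ?f = "\<lambda>\<zeta>. (\<zeta> + z) / (\<zeta> - z)"
  have T: "bounded_linear (\<lambda>A. Re (cdot (A *v v) v))"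
    by (rule bounded_linear_compose[OF bounded_linear_Re bounded_linear_cdot_matrix])
  have Wi: "integrable ?\<mu> W" and Wp: "AE x in ?\<mu>. psd (W x)" using W unfolding trace_density_def by auto
  note int = integrable_poisson(2)[OF sets_trace_measure Wi z]
  have gm: "(\<lambda>x. Re (cdot (W x *v v) v)) \<in> borel_measurable ?\<mu>"
    using integrable_bounded_linear[OF T Wi] by simp
  have g0: "AE x in ?\<mu>. 0 \<le> Re (cdot (W x *v v) v)"
    using Wp by eventually_elim (simp add: psd_def)
  have fi: "integrable (form_measure M v) ?f" and fJ: "cdot (J *v v) v = (LINT x|form_measure M v. ?f x)"
    using J unfolding has_matrix_integral_def by auto
  have "Re (cdot (J *v v) v) = (LINT x|form_measure M v. poisson z x)"
    unfolding fJ poisson_def by (rule integral_Re[OF fi, symmetric])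
  also have "\<dots> = (LINT x|?\<mu>. Re (cdot (W x *v v) v) *\<^sub>R poisson z x)"
    unfolding form_measure_eq_density[OF M W]
    by (rule integral_density[OF integrable_poisson(1)[OF sets_trace_measure Wi z] gm g0])
  also have "\<dots> = (LINT x|?\<mu>. Re (cdot ((poisson z x *\<^sub>R W x) *v v) v))"
    by (simp add: scaleR_matrix_apply cdot_scaleR_left mult.commute)
  also have "\<dots> = Re (cdot (poisson_integral ?\<mu> W z *v v) v)"
    unfolding poisson_integral_def by (rule integral_bounded_linear[OF T int])
  finally show ?thesis .
qed

section \<open>Non-tangential boundary behaviour\<close>

text \<open>In the Stolz region \<open>z\<close> is within \<open>t (1 - |z|)\<close> of
  \<open>\<xi>\<close>, and \<open>1 - |z|\<close> never exceeds \<open>|\<zeta> - z|\<close>.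
  Triangle inequalities therefore make \<open>|\<zeta> - z|\<close> comparable with
  \<open>dist \<xi> \<zeta> + t (1 - |z|)\<close>.\<close>

lemma poisson_bounds:
  assumes \<zeta>: "norm \<zeta> = 1" and z: "z \<in> stolz t \<xi>" and \<xi>: "norm \<xi> = 1" and t: "t > 1"
  defines "k \<equiv> 1 / (dist \<xi> \<zeta> + t * (1 - cmod z))\<^sup>2"
  shows "(1 - (cmod z)\<^sup>2) * k \<le> poisson z \<zeta>" "poisson z \<zeta> \<le> (1 - (cmod z)\<^sup>2) * (1 + 2 * t)\<^sup>2 * k"
proof -
  define h where "h = 1 - cmod z"
  have z1: "cmod z < 1" and zt: "cmod (z - \<xi>) < t * h" using z by (auto simp: stolz_def h_def)
  have h: "0 < h" using z1 by (simp add: h_def)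
  have a: "0 \<le> 1 - (cmod z)\<^sup>2" using z1 by (simp add: power_le_one)
  have hz: "h \<le> cmod (\<zeta> - z)" using norm_triangle_ineq2[of \<zeta> z] \<zeta> by (simp add: h_def)
  have 1: "cmod (\<zeta> - z) \<le> dist \<xi> \<zeta> + t * h"
    using norm_triangle_ineq[of "\<zeta> - \<xi>" "\<xi> - z"] zt by (simp add: dist_norm norm_minus_commute)
  have "dist \<xi> \<zeta> \<le> cmod (\<zeta> - z) + t * h"
    using norm_triangle_ineq[of "\<zeta> - z" "z - \<xi>"] zt by (simp add: dist_norm norm_minus_commute)
  moreover have "t * h \<le> t * cmod (\<zeta> - z)" using hz t by (intro mult_left_mono) auto
  \<comment> \<open>The Stolz error occurs twice, once from replacing \<open>\<xi>\<close> by
    \<open>z\<close> and once in the sum itself; hence the factor \<open>1 + 2 * t\<close>.\<close>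
  ultimately have 2: "dist \<xi> \<zeta> + t * h \<le> (1 + 2 * t) * cmod (\<zeta> - z)" by (simp add: algebra_simps)
  have pos: "0 < cmod (\<zeta> - z)" "0 < dist \<xi> \<zeta> + t * h"
    using h hz t by (auto intro!: add_nonneg_pos)
  have "k \<le> 1 / (cmod (\<zeta> - z))\<^sup>2"
    unfolding k_def h_def[symmetric] using 1 pos by (intro divide_left_mono power_mono) auto
  from mult_left_mono[OF this a] show "(1 - (cmod z)\<^sup>2) * k \<le> poisson z \<zeta>"
    by (simp add: poisson_eq[OF \<zeta>])
  have "(dist \<xi> \<zeta> + t * h)\<^sup>2 \<le> ((1 + 2 * t) * cmod (\<zeta> - z))\<^sup>2"
    using 2 pos by (intro power_mono) auto
  then have "(dist \<xi> \<zeta> + t * h)\<^sup>2 \<le> (1 + 2 * t)\<^sup>2 * (cmod (\<zeta> - z))\<^sup>2"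
    by (simp only: power_mult_distrib)
  moreover have "1 / C \<le> S * (1 / D)" if "D \<le> S * C" "0 < C" "0 < D" for C D S :: real
    using that by (simp add: field_simps)
  ultimately have "1 / (cmod (\<zeta> - z))\<^sup>2 \<le> (1 + 2 * t)\<^sup>2 * k"
    unfolding k_def h_def[symmetric] using pos by (meson zero_less_power)
  from mult_left_mono[OF this a] show "poisson z \<zeta> \<le> (1 - (cmod z)\<^sup>2) * (1 + 2 * t)\<^sup>2 * k"
    by (simp add: poisson_eq[OF \<zeta>] mult.assoc)
qed

text \<open>On a Stolz region the Poisson kernel is comparable with the function
  \<open>\<zeta> \<mapsto> (|\<zeta> - \<xi>| + t(1 - |z|))\<^sup>-\<^sup>2\<close>, whose superlevel sets are balls around \<open>\<xi>\<close>; inside radius \<open>\<delta>\<close> the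
  layer-cake formula therefore applies, and outside the kernel is bounded.\<close>

lemma nn_integral_poisson_le:
  fixes \<mu> \<nu> :: "complex measure"
  assumes fin: "finite_measure \<mu>" "finite_measure \<nu>"
    and sets\<mu>: "sets \<mu> = sets circle_borel" and sets\<nu>: "sets \<nu> = sets circle_borel"
    and \<xi>: "norm \<xi> = 1" and t: "t > 1" and z: "z \<in> stolz t \<xi>" and "0 < \<delta>" "0 \<le> c"
    and le: "\<And>s. \<lbrakk>0 < s; s \<le> \<delta>\<rbrakk> \<Longrightarrow>
      emeasure \<nu> (sphere 0 1 \<inter> ball \<xi> s) \<le> ennreal c * emeasure \<mu> (sphere 0 1 \<inter> ball \<xi> s)"
  shows "(\<integral>\<^sup>+\<zeta>. ennreal (poisson z \<zeta>) \<partial>\<nu>) \<le> ennreal ((1 + 2 * t)\<^sup>2 * c) * (\<integral>\<^sup>+\<zeta>. ennreal (poisson z \<zeta>) \<partial>\<mu>)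
    + ennreal ((1 + 2 * t)\<^sup>2 / \<delta>\<^sup>2) * emeasure \<nu> (space \<nu>)"
proof -
  define h where "h = t * (1 - cmod z)"
  define a where "a = 1 - (cmod z)\<^sup>2"
  define T where "T = (1 + 2 * t)\<^sup>2"
  define k where "k \<zeta> = (if dist \<xi> \<zeta> < \<delta> then 1 / (dist \<xi> \<zeta> + h)\<^sup>2 else 0)" for \<zeta>
  have z1: "cmod z < 1" using z by (simp add: stolz_def)
  have h: "0 < h" using z1 t by (simp add: h_def)
  have a: "0 \<le> a" "a \<le> 1" using z1 by (auto simp: a_def power_le_one)
  have T: "0 \<le> T" by (simp add: T_def)
  have sp: "space \<mu> = sphere 0 1" "space \<nu> = sphere 0 1"
    using sets_eq_imp_space_eq[OF sets\<mu>] sets_eq_imp_space_eq[OF sets\<nu>] by simp_all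
  have k0: "0 \<le> k \<zeta>" for \<zeta> by (simp add: k_def)
  have "k \<in> borel_measurable borel" unfolding k_def by measurable
  then have km: "k \<in> borel_measurable \<mu>" "k \<in> borel_measurable \<nu>"
    using sets\<mu> sets\<nu> by (simp_all add: circle_borel_def measurable_restrict_space1 cong: measurable_cong_sets)
  have lower: "a * k \<zeta> \<le> poisson z \<zeta>" if "\<zeta> \<in> sphere 0 1" for \<zeta>
    using poisson_bounds(1)[OF _ z \<xi> t, of \<zeta>] poisson_nonneg[of \<zeta> z] that z1
    by (auto simp: k_def a_def h_def)
  have upper: "poisson z \<zeta> \<le> a * T * k \<zeta> + T / \<delta>\<^sup>2" if "\<zeta> \<in> sphere 0 1" for \<zeta>
  proof -
    have "1 / (dist \<xi> \<zeta> + h)\<^sup>2 \<le> k \<zeta> + 1 / \<delta>\<^sup>2"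
    proof (cases "dist \<xi> \<zeta> < \<delta>")
      case False
      then show ?thesis using h \<open>0 < \<delta>\<close> by (auto simp: k_def intro!: divide_left_mono power_mono)
    qed (simp add: k_def)
    then have le: "a * T * (1 / (dist \<xi> \<zeta> + h)\<^sup>2) \<le> a * T * (k \<zeta> + 1 / \<delta>\<^sup>2)"
      using a T by (intro mult_left_mono) auto
    have "poisson z \<zeta> \<le> a * T * (1 / (dist \<xi> \<zeta> + h)\<^sup>2)"
      using poisson_bounds(2)[OF _ z \<xi> t, of \<zeta>] that by (simp add: a_def T_def h_def)
    also note le
    also have "a * T * (k \<zeta> + 1 / \<delta>\<^sup>2) = a * T * k \<zeta> + a * (T / \<delta>\<^sup>2)"
      by (simp add: distrib_left)
    also have "a * (T / \<delta>\<^sup>2) \<le> T / \<delta>\<^sup>2"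
      using a T by (intro mult_left_le_one_le) auto
    finally show ?thesis by simp
  qed
  have "(\<integral>\<^sup>+\<zeta>. ennreal (k \<zeta>) \<partial>\<nu>) \<le> ennreal c * (\<integral>\<^sup>+\<zeta>. ennreal (k \<zeta>) \<partial>\<mu>)"
  proof (rule nn_integral_le_superlevel[OF fin(2,1)])
    fix y :: real assume y: "0 < y"
    have iff: "y < 1 / (d + h)\<^sup>2 \<longleftrightarrow> d < 1 / sqrt y - h" if "0 \<le> d" for d
    proof -
      have "0 < d + h" using that h by simp
      moreover have "(sqrt y * (d + h))\<^sup>2 = y * (d + h)\<^sup>2" using y by (simp only: power_mult_distrib) simp
      ultimately have "y < 1 / (d + h)\<^sup>2 \<longleftrightarrow> (sqrt y * (d + h))\<^sup>2 < 1\<^sup>2"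
        by (simp add: pos_less_divide_eq)
      also have "\<dots> \<longleftrightarrow> sqrt y * (d + h) < 1"
        using that h y by (intro power_mono_iff[THEN arg_cong[where f=Not], simplified not_le]) auto
      also have "\<dots> \<longleftrightarrow> d < 1 / sqrt y - h" using y by (simp add: field_simps)
      finally show ?thesis .
    qed
    \<comment> \<open>Above level \<open>y\<close> the profile \<open>k\<close> fills the ball of
      radius \<open>s\<close>. Truncation at \<open>\<delta>\<close> keeps
      \<open>s \<le> \<delta>\<close>, where \<open>le\<close> applies; a nonpositive
      \<open>s\<close> gives the empty set.\<close>
    define s where "s = min \<delta> (1 / sqrt y - h)"
    have eq: "{\<zeta>\<in>space \<mu>. y < k \<zeta>} = sphere 0 1 \<inter> ball \<xi> s"
      using y iff by (auto simp: sp k_def s_def split: if_splits)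
    show "emeasure \<nu> {\<zeta>\<in>space \<mu>. y < k \<zeta>} \<le> ennreal c * emeasure \<mu> {\<zeta>\<in>space \<mu>. y < k \<zeta>}"
    proof (cases "0 < s")
      case True
      then show ?thesis unfolding eq by (intro le) (auto simp: s_def)
    next
      case False
      then have "ball \<xi> s = {}" by simp
      then have "sphere 0 1 \<inter> ball \<xi> s = {}" by (simp only: Int_empty_right)
      then show ?thesis unfolding eq by (simp only: emeasure_empty zero_le)
    qed
  qed (use sets\<mu> sets\<nu> km in auto)
  then have "ennreal (a * T) * (\<integral>\<^sup>+\<zeta>. ennreal (k \<zeta>) \<partial>\<nu>) \<le> ennreal (a * T) * (ennreal c * (\<integral>\<^sup>+\<zeta>. ennreal (k \<zeta>) \<partial>\<mu>))"
    by (rule mult_left_mono) simp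
  also have "\<dots> = ennreal (T * c) * (\<integral>\<^sup>+\<zeta>. ennreal (a * k \<zeta>) \<partial>\<mu>)"
    using a T \<open>0 \<le> c\<close> km k0 by (simp add: ennreal_mult nn_integral_cmult mult_ac)
  also have "\<dots> \<le> ennreal (T * c) * (\<integral>\<^sup>+\<zeta>. ennreal (poisson z \<zeta>) \<partial>\<mu>)"
    using lower by (intro mult_left_mono nn_integral_mono ennreal_leI) (auto simp: sp)
  finally have *: "ennreal (a * T) * (\<integral>\<^sup>+\<zeta>. ennreal (k \<zeta>) \<partial>\<nu>) \<le> \<dots>" .
  have "(\<integral>\<^sup>+\<zeta>. ennreal (poisson z \<zeta>) \<partial>\<nu>) \<le> (\<integral>\<^sup>+\<zeta>. ennreal (a * T) * ennreal (k \<zeta>) + ennreal (T / \<delta>\<^sup>2) \<partial>\<nu>)"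
  proof (rule nn_integral_mono)
    fix \<zeta> assume "\<zeta> \<in> space \<nu>"
    then have "ennreal (poisson z \<zeta>) \<le> ennreal (a * T * k \<zeta> + T / \<delta>\<^sup>2)"
      using upper sp by (intro ennreal_leI) auto
    also have "\<dots> = ennreal (a * T) * ennreal (k \<zeta>) + ennreal (T / \<delta>\<^sup>2)"
      using a T k0[of \<zeta>] by (simp add: ennreal_plus ennreal_mult)
    finally show "ennreal (poisson z \<zeta>) \<le> \<dots>" .
  qed
  also have "\<dots> = ennreal (a * T) * (\<integral>\<^sup>+\<zeta>. ennreal (k \<zeta>) \<partial>\<nu>) + ennreal (T / \<delta>\<^sup>2) * emeasure \<nu> (space \<nu>)"
    using km by (simp add: nn_integral_add nn_integral_cmult)
  also have "\<dots> \<le> ennreal (T * c) * (\<integral>\<^sup>+\<zeta>. ennreal (poisson z \<zeta>) \<partial>\<mu>)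
      + ennreal (T / \<delta>\<^sup>2) * emeasure \<nu> (space \<nu>)"
    using * by (rule add_right_mono)
  finally show ?thesis by (simp add: T_def)
qed

lemma nn_integral_poisson:
  assumes "finite_measure \<mu>" "sets \<mu> = sets circle_borel" "norm z < 1"
  shows "(\<integral>\<^sup>+\<zeta>. ennreal (poisson z \<zeta>) \<partial>\<mu>) = ennreal (poisson_integral \<mu> (\<lambda>_. 1) z)"
    and "0 \<le> poisson_integral \<mu> (\<lambda>_. 1::real) z"
proof -
  interpret finite_measure \<mu> by fact
  have sp: "space \<mu> = sphere 0 1" using sets_eq_imp_space_eq[OF assms(2)] by simp
  have pos: "AE \<zeta> in \<mu>. 0 \<le> poisson z \<zeta>"
    using assms(3) by (intro AE_I2) (auto simp: sp intro!: poisson_nonneg)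
  have "integrable \<mu> (\<lambda>\<zeta>. poisson z \<zeta> *\<^sub>R (1::real))"
    using assms by (intro integrable_poisson) auto
  then show "(\<integral>\<^sup>+\<zeta>. ennreal (poisson z \<zeta>) \<partial>\<mu>) = ennreal (poisson_integral \<mu> (\<lambda>_. 1) z)"
    using nn_integral_eq_integral[OF _ pos] by (simp add: poisson_integral_def)
  show "0 \<le> poisson_integral \<mu> (\<lambda>_. 1::real) z"
    using integral_nonneg_AE[OF pos] by (simp add: poisson_integral_def)
qed

lemma eventually_stolz_near:
  assumes "norm \<xi> = 1" "\<delta> > 0"
  shows "eventually (\<lambda>z. z \<in> stolz t \<xi> \<and> 1 - cmod z < \<delta>) (at \<xi> within stolz t \<xi>)"
  unfolding eventually_at
proof (intro exI conjI ballI impI)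
  show "0 < \<delta>" by fact
  fix z assume "z \<in> stolz t \<xi>" "z \<noteq> \<xi> \<and> dist z \<xi> < \<delta>"
  then show "z \<in> stolz t \<xi>" "1 - cmod z < \<delta>"
    using norm_triangle_ineq2[of \<xi> z] assms(1) by (auto simp: dist_norm norm_minus_commute)
qed

text \<open>On the ball of radius \<open>h = 1 - |z|\<close> the kernel is at least
  \<open>1 / (h * (1 + t)^2)\<close>, while the hypothesis makes the mass of that ball large
  compared with \<open>h\<close>.\<close>

lemma poisson_integral_at_top:
  assumes fin: "finite_measure \<mu>" and sets: "sets \<mu> = sets circle_borel"
    and \<xi>: "norm \<xi> = 1" and t: "t > 1"
    and dens: "\<forall>c>0. \<exists>\<delta>>0. \<forall>s. 0 < s \<and> s < \<delta> \<longrightarrow>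
      ennreal s \<le> ennreal c * emeasure \<mu> (sphere 0 1 \<inter> ball \<xi> s)"
  shows "filterlim (poisson_integral \<mu> (\<lambda>_. 1::real)) at_top (at \<xi> within stolz t \<xi>)"
  unfolding filterlim_at_top_ge[where c="1::real"]
proof safe
  interpret finite_measure \<mu> by fact
  fix K :: real assume K: "1 \<le> K"
  \<comment> \<open>With this \<open>c\<close> the lower bound for the kernel, multiplied by a mass
    \<open>h / c\<close>, equals \<open>K\<close>.\<close>
  define c where "c = 1 / (K * (1 + t)\<^sup>2)"
  have c: "0 < c" using K t by (simp add: c_def)
  then obtain \<delta> where \<delta>: "\<delta> > 0" and d: "\<And>s. \<lbrakk>0 < s; s < \<delta>\<rbrakk> \<Longrightarrow>
      ennreal s \<le> ennreal c * emeasure \<mu> (sphere 0 1 \<inter> ball \<xi> s)"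
    using dens by blast
  show "eventually (\<lambda>z. K \<le> poisson_integral \<mu> (\<lambda>_. 1) z) (at \<xi> within stolz t \<xi>)"
    using eventually_stolz_near[OF \<xi> \<delta>]
  proof eventually_elim
    case (elim z)
    define h where "h = 1 - cmod z"
    define m where "m = measure \<mu> (sphere 0 1 \<inter> ball \<xi> h)"
    have z1: "cmod z < 1" using elim by (simp add: stolz_def)
    have h: "0 < h" "h < \<delta>" "h \<le> 1" using elim z1 by (auto simp: h_def)
    have "ennreal h \<le> ennreal (c * m)"
      using d[OF h(1,2)] c by (simp add: m_def emeasure_eq_measure ennreal_mult)
    then have hm: "h \<le> c * m" using c by (simp add: m_def)
    have lower: "1 / (h * (1 + t)\<^sup>2) \<le> poisson z \<zeta>" if "\<zeta> \<in> sphere 0 1 \<inter> ball \<xi> h" for \<zeta>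
    proof -
      have "dist \<xi> \<zeta> + t * h \<le> h * (1 + t)" using that by (simp add: algebra_simps)
      then have "1 / (h * (1 + t))\<^sup>2 \<le> 1 / (dist \<xi> \<zeta> + t * h)\<^sup>2"
        using h t by (intro divide_left_mono power_mono mult_pos_pos zero_less_power) (auto intro!: add_nonneg_pos)
      then have "h * (1 / (h * (1 + t))\<^sup>2) \<le> (1 - (cmod z)\<^sup>2) * (1 / (dist \<xi> \<zeta> + t * h)\<^sup>2)"
      proof (rule mult_mono[rotated])
        have "(cmod z)\<^sup>2 \<le> cmod z" using z1 by (simp add: power2_eq_square mult_left_le)
        then show "h \<le> 1 - (cmod z)\<^sup>2" by (simp add: h_def)
        then show "0 \<le> 1 - (cmod z)\<^sup>2" using h by simp
      qed simp
      also have "\<dots> \<le> poisson z \<zeta>"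
        using poisson_bounds(1)[of \<zeta> z t \<xi>] elim that \<xi> t by (simp add: h_def)
      also have "h * (1 / (h * (1 + t))\<^sup>2) = 1 / (h * (1 + t)\<^sup>2)"
        using h by (simp only: power_mult_distrib) (simp add: power2_eq_square[of h])
      finally show ?thesis .
    qed
    have "K = (1 / (h * (1 + t)\<^sup>2)) * (h / c)" using h c K t by (simp add: c_def field_simps)
    also have "\<dots> \<le> (1 / (h * (1 + t)\<^sup>2)) * m"
      using h c hm by (intro mult_left_mono) (auto simp: field_simps)
    finally have "ennreal K \<le> ennreal (1 / (h * (1 + t)\<^sup>2)) * ennreal m"
      using h by (simp add: ennreal_mult[symmetric] m_def)
    also have "\<dots> = (\<integral>\<^sup>+\<zeta>. ennreal (1 / (h * (1 + t)\<^sup>2)) * indicator (sphere 0 1 \<inter> ball \<xi> h) \<zeta> \<partial>\<mu>)"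
      by (subst nn_integral_cmult_indicator)
        (auto simp: sets sphere_Int_circle_borel m_def emeasure_eq_measure)
    also have "\<dots> \<le> (\<integral>\<^sup>+\<zeta>. ennreal (poisson z \<zeta>) \<partial>\<mu>)"
      using lower by (intro nn_integral_mono) (auto simp: indicator_def intro!: ennreal_leI)
    also have "\<dots> = ennreal (poisson_integral \<mu> (\<lambda>_. 1) z)"
      by (rule nn_integral_poisson(1)[OF fin sets z1])
    finally show ?case
      using nn_integral_poisson(2)[OF fin sets z1] K by (simp add: ennreal_le_iff)
  qed
qed

text \<open>The density depends on \<open>\<xi>\<close>, so a single application of the
  differentiation theorem does not serve all points. It is applied to \<open>g q n\<close> for
  \<open>q\<close> in a countable dense set, and
  \<open>|f - f \<xi>| \<le> g q n + 2 / Suc n\<close> whenever \<open>q\<close> is within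
  \<open>1 / Suc n\<close> of \<open>f \<xi>\<close>.\<close>

lemma AE_lebesgue_point:
  fixes f :: "complex \<Rightarrow> 'b::{banach, second_countable_topology}"
  assumes fin: "finite_measure \<mu>" and sets: "sets \<mu> = sets circle_borel" and f: "integrable \<mu> f"
  shows "AE \<xi> in \<mu>. \<forall>c>0. \<exists>\<delta>>0. \<forall>s. 0 < s \<and> s < \<delta> \<longrightarrow>
    emeasure (density \<mu> (\<lambda>\<zeta>. ennreal (norm (f \<zeta> - f \<xi>)))) (sphere 0 1 \<inter> ball \<xi> s)
      \<le> ennreal c * emeasure \<mu> (sphere 0 1 \<inter> ball \<xi> s)"
proof -
  interpret finite_measure \<mu> by fact
  have fm [measurable]: "f \<in> borel_measurable \<mu>" using f by simp
  obtain D :: "'b set" where D: "countable D" "\<And>X. open X \<Longrightarrow> X \<noteq> {} \<Longrightarrow> \<exists>d\<in>D. d \<in> X"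
    by (rule countable_dense_setE) (rule that)
  define g where "g q n \<zeta> = max 0 (norm (f \<zeta> - q) - 1 / Suc n)" for q n \<zeta>
  have gm [measurable]: "g q n \<in> borel_measurable \<mu>" for q n unfolding g_def by measurable
  define A where "A q n = {\<zeta> \<in> space \<mu>. norm (f \<zeta> - q) \<le> 1 / Suc n}" for q :: 'b and n :: nat
  have Am: "A q n \<in> sets \<mu>" for q n unfolding A_def by measurable
  have "AE \<xi> in \<mu>. \<xi> \<in> A q n \<longrightarrow> (\<forall>c>0. \<exists>\<delta>>0. \<forall>s. 0 < s \<and> s < \<delta> \<longrightarrow>
      emeasure (density \<mu> (\<lambda>\<zeta>. ennreal (g q n \<zeta>))) (sphere 0 1 \<inter> ball \<xi> s)
      \<le> ennreal c * emeasure \<mu> (sphere 0 1 \<inter> ball \<xi> s))" for q n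
  proof (rule AE_ball_ratio_tendsto_0[OF fin _ sets])
    have "integrable \<mu> (g q n)"
      unfolding g_def using f by (intro integrable_max Bochner_Integration.integrable_diff integrable_norm) auto
    then have "(\<integral>\<^sup>+\<zeta>. ennreal (g q n \<zeta>) \<partial>\<mu>) < \<infinity>"
      using integrable_iff_bounded[of \<mu> "g q n"] by (simp add: g_def)
    then show "finite_measure (density \<mu> (\<lambda>\<zeta>. ennreal (g q n \<zeta>)))"
      by (intro finite_measureI) (simp add: emeasure_density cong: nn_integral_cong)
    show "sets (density \<mu> (\<lambda>\<zeta>. ennreal (g q n \<zeta>))) = sets circle_borel" using sets by simp
    show "A q n \<in> sets circle_borel" using Am sets by simp
    have "emeasure (density \<mu> (\<lambda>\<zeta>. ennreal (g q n \<zeta>))) (A q n) = (\<integral>\<^sup>+\<zeta>. ennreal (g q n \<zeta>) * indicator (A q n) \<zeta> \<partial>\<mu>)"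
      using Am by (intro emeasure_density) auto
    also have "\<dots> = (\<integral>\<^sup>+\<zeta>. 0 \<partial>\<mu>)"
      by (intro nn_integral_cong) (auto simp: indicator_def A_def g_def)
    finally show "emeasure (density \<mu> (\<lambda>\<zeta>. ennreal (g q n \<zeta>))) (A q n) = 0" by simp
  qed
  then have "AE \<xi> in \<mu>. \<forall>q\<in>D. \<forall>n. \<xi> \<in> A q n \<longrightarrow> (\<forall>c>0. \<exists>\<delta>>0. \<forall>s. 0 < s \<and> s < \<delta> \<longrightarrow>
      emeasure (density \<mu> (\<lambda>\<zeta>. ennreal (g q n \<zeta>))) (sphere 0 1 \<inter> ball \<xi> s)
      \<le> ennreal c * emeasure \<mu> (sphere 0 1 \<inter> ball \<xi> s))"
    using D(1) by (simp add: AE_ball_countable AE_all_countable)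
  then show ?thesis
    using AE_space
  proof eventually_elim
    case (elim \<xi>)
    show ?case
    proof (intro allI impI)
      fix c :: real assume "0 < c"
      \<comment> \<open>One third of \<open>c\<close> is reserved for \<open>g q n\<close>, the
        other two for the two errors \<open>1 / Suc n\<close>.\<close>
      then obtain n where n: "1 / Suc n < c / 3" using nat_approx_posE[of "c / 3"] by auto
      obtain q where q: "q \<in> D" "q \<in> ball (f \<xi>) (1 / Suc n)"
        using D(2)[of "ball (f \<xi>) (1 / Suc n)"] by auto
      have "\<xi> \<in> A q n" using q(2) elim(2) by (auto simp: A_def dist_norm)
      then obtain \<delta> where \<delta>: "\<delta> > 0" and d: "\<And>s. \<lbrakk>0 < s; s < \<delta>\<rbrakk> \<Longrightarrow>
          emeasure (density \<mu> (\<lambda>\<zeta>. ennreal (g q n \<zeta>))) (sphere 0 1 \<inter> ball \<xi> s)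
          \<le> ennreal (c / 3) * emeasure \<mu> (sphere 0 1 \<inter> ball \<xi> s)"
        using elim(1) q(1) \<open>0 < c\<close> by (metis (no_types, lifting) zero_less_divide_iff zero_less_numeral)
      have "emeasure (density \<mu> (\<lambda>\<zeta>. ennreal (norm (f \<zeta> - f \<xi>)))) B \<le> ennreal c * emeasure \<mu> B"
        if s: "0 < s" "s < \<delta>" and B: "B = sphere 0 1 \<inter> ball \<xi> s" for s B
      proof -
        have Bm: "B \<in> sets \<mu>" unfolding B sets by (intro sphere_Int_circle_borel) auto
        have pt: "norm (f \<zeta> - f \<xi>) \<le> g q n \<zeta> + 2 * c / 3" for \<zeta>
          using norm_triangle_ineq[of "f \<zeta> - q" "q - f \<xi>"] q(2) n
          by (auto simp: g_def dist_norm norm_minus_commute)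
        have "emeasure (density \<mu> (\<lambda>\<zeta>. ennreal (norm (f \<zeta> - f \<xi>)))) B
            = (\<integral>\<^sup>+\<zeta>. ennreal (norm (f \<zeta> - f \<xi>)) * indicator B \<zeta> \<partial>\<mu>)"
          using Bm by (intro emeasure_density) auto
        also have "\<dots> \<le> (\<integral>\<^sup>+\<zeta>. ennreal (g q n \<zeta>) * indicator B \<zeta> + ennreal (2 * c / 3) * indicator B \<zeta> \<partial>\<mu>)"
        proof (rule nn_integral_mono)
          fix \<zeta>
          have "0 \<le> g q n \<zeta>" by (simp add: g_def)
          have "ennreal (norm (f \<zeta> - f \<xi>)) \<le> ennreal (g q n \<zeta> + 2 * c / 3)"
            by (rule ennreal_leI[OF pt])
          also have "\<dots> = ennreal (g q n \<zeta>) + ennreal (2 * c / 3)"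
            using \<open>0 \<le> g q n \<zeta>\<close> \<open>0 < c\<close> by (intro ennreal_plus) auto
          finally show "ennreal (norm (f \<zeta> - f \<xi>)) * indicator B \<zeta>
              \<le> ennreal (g q n \<zeta>) * indicator B \<zeta> + ennreal (2 * c / 3) * indicator B \<zeta>"
            by (auto simp: indicator_def)
        qed
        also have "\<dots> = emeasure (density \<mu> (\<lambda>\<zeta>. ennreal (g q n \<zeta>))) B + ennreal (2 * c / 3) * emeasure \<mu> B"
          using Bm by (subst nn_integral_add) (auto simp: emeasure_density nn_integral_cmult_indicator)
        also have "\<dots> \<le> ennreal (c / 3) * emeasure \<mu> B + ennreal (2 * c / 3) * emeasure \<mu> B"
          using d[OF s] unfolding B by (rule add_right_mono)
        also have "\<dots> = ennreal c * emeasure \<mu> B"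
          using \<open>0 < c\<close> by (simp add: distrib_right[symmetric] ennreal_plus[symmetric] del: ennreal_plus)
        finally show ?thesis .
      qed
      then show "\<exists>\<delta>>0. \<forall>s. 0 < s \<and> s < \<delta> \<longrightarrow>
          emeasure (density \<mu> (\<lambda>\<zeta>. ennreal (norm (f \<zeta> - f \<xi>)))) (sphere 0 1 \<inter> ball \<xi> s)
          \<le> ennreal c * emeasure \<mu> (sphere 0 1 \<inter> ball \<xi> s)"
        using \<delta> by blast
    qed
  qed
qed

text \<open>Subtracting \<open>f \<xi>\<close> times the Poisson integral \<open>p\<close> of 1
  leaves the Poisson integral of \<open>f - f \<xi>\<close>. By
  \<open>nn_integral_poisson_le\<close> its norm is at most a small multiple of \<open>p\<close>
  plus a constant, and the growth of \<open>p\<close> absorbs the constant.\<close>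

lemma poisson_integral_ratio_tendsto:
  fixes f :: "complex \<Rightarrow> 'b::{banach, second_countable_topology}"
  assumes fin: "finite_measure \<mu>" and sets: "sets \<mu> = sets circle_borel" and f: "integrable \<mu> f"
    and \<xi>: "norm \<xi> = 1" and t: "t > 1"
    and leb: "\<forall>c>0. \<exists>\<delta>>0. \<forall>s. 0 < s \<and> s < \<delta> \<longrightarrow>
      emeasure (density \<mu> (\<lambda>\<zeta>. ennreal (norm (f \<zeta> - f \<xi>)))) (sphere 0 1 \<inter> ball \<xi> s)
      \<le> ennreal c * emeasure \<mu> (sphere 0 1 \<inter> ball \<xi> s)"
    and top: "filterlim (poisson_integral \<mu> (\<lambda>_. 1::real)) at_top (at \<xi> within stolz t \<xi>)"
  shows "((\<lambda>z. (1 / poisson_integral \<mu> (\<lambda>_. 1) z) *\<^sub>R poisson_integral \<mu> f z) \<longlongrightarrow> f \<xi>)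
    (at \<xi> within stolz t \<xi>)"
proof (rule tendstoI)
  interpret finite_measure \<mu> by fact
  fix \<epsilon> :: real assume \<epsilon>: "0 < \<epsilon>"
  let ?p = "poisson_integral \<mu> (\<lambda>_. 1::real)"
  define g where "g \<zeta> = norm (f \<zeta> - f \<xi>)" for \<zeta>
  define \<nu> where "\<nu> = density \<mu> (\<lambda>\<zeta>. ennreal (g \<zeta>))"
  define T where "T = (1 + 2 * t)\<^sup>2"
  have T: "T > 0" using t by (simp add: T_def)
  have fd: "integrable \<mu> (\<lambda>\<zeta>. f \<zeta> - f \<xi>)" using f by simp
  have gi: "integrable \<mu> g" unfolding g_def using fd by simp
  have gm: "g \<in> borel_measurable \<mu>" using gi by simp
  have "(\<integral>\<^sup>+\<zeta>. ennreal (g \<zeta>) \<partial>\<mu>) < \<infinity>"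
    using gi integrable_iff_bounded[of \<mu> g] by (simp add: g_def)
  then have fin\<nu>: "finite_measure \<nu>"
    unfolding \<nu>_def using gm by (intro finite_measureI) (simp add: emeasure_density cong: nn_integral_cong)
  interpret \<nu>: finite_measure \<nu> by fact
  have sets\<nu>: "sets \<nu> = sets circle_borel" using sets by (simp add: \<nu>_def)
  define V where "V = measure \<nu> (space \<nu>)"
  \<comment> \<open>Chosen so that \<open>T * c = \<epsilon> / 3\<close>. The threshold
    \<open>K\<close> below makes the constant at most another third of
    \<open>\<epsilon> * p\<close>, which leaves a strict inequality.\<close>
  define c where "c = \<epsilon> / (3 * T)"
  have c: "0 < c" using \<epsilon> T by (simp add: c_def)
  obtain \<delta>' where \<delta>': "\<delta>' > 0" and d': "\<And>s. \<lbrakk>0 < s; s < \<delta>'\<rbrakk> \<Longrightarrow>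
      emeasure \<nu> (sphere 0 1 \<inter> ball \<xi> s) \<le> ennreal c * emeasure \<mu> (sphere 0 1 \<inter> ball \<xi> s)"
    using leb c unfolding \<nu>_def g_def by blast
  \<comment> \<open>\<open>nn_integral_poisson_le\<close> asks for the estimate up to and including
    the radius, whereas \<open>d'\<close> gives it strictly below \<open>\<delta>'\<close>.\<close>
  define \<delta> where "\<delta> = \<delta>' / 2"
  have \<delta>: "\<delta> > 0" using \<delta>' by (simp add: \<delta>_def)
  have d: "emeasure \<nu> (sphere 0 1 \<inter> ball \<xi> s) \<le> ennreal c * emeasure \<mu> (sphere 0 1 \<inter> ball \<xi> s)"
    if "0 < s" "s \<le> \<delta>" for s
    using that \<delta>' by (intro d') (auto simp: \<delta>_def)
  define K where "K = max 1 (3 * (T / \<delta>\<^sup>2 * V) / \<epsilon>)"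
  have "eventually (\<lambda>z. K \<le> ?p z) (at \<xi> within stolz t \<xi>)"
    using top unfolding filterlim_at_top by blast
  then show "eventually (\<lambda>z. dist ((1 / ?p z) *\<^sub>R poisson_integral \<mu> f z) (f \<xi>) < \<epsilon>) (at \<xi> within stolz t \<xi>)"
    using eventually_stolz_near[OF \<xi> zero_less_one]
  proof eventually_elim
    case (elim z)
    have z: "z \<in> stolz t \<xi>" "z \<in> ball 0 1" and z1: "norm z < 1" using elim by (auto simp: stolz_def)
    have p: "1 \<le> ?p z" "3 * (T / \<delta>\<^sup>2 * V) / \<epsilon> \<le> ?p z" using elim by (auto simp: K_def)
    have sp: "space \<mu> = sphere 0 1" using sets_eq_imp_space_eq[OF sets] by simp
    define q where "q = (LINT \<zeta>|\<mu>. poisson z \<zeta> * g \<zeta>)"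
    have pm: "poisson z \<in> borel_measurable \<mu>" by (rule integrable_poisson(1)[OF sets gi z(2)])
    have qi: "integrable \<mu> (\<lambda>\<zeta>. poisson z \<zeta> * g \<zeta>)"
      using integrable_poisson(2)[OF sets gi z(2)] by simp
    have q0: "AE \<zeta> in \<mu>. 0 \<le> poisson z \<zeta> * g \<zeta>"
      using z1 by (intro AE_I2) (auto simp: sp g_def intro!: mult_nonneg_nonneg poisson_nonneg)
    have "ennreal q = (\<integral>\<^sup>+\<zeta>. ennreal (poisson z \<zeta> * g \<zeta>) \<partial>\<mu>)"
      unfolding q_def by (rule nn_integral_eq_integral[OF qi q0, symmetric])
    also have "\<dots> = (\<integral>\<^sup>+\<zeta>. ennreal (g \<zeta>) * ennreal (poisson z \<zeta>) \<partial>\<mu>)"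
      using z1 by (intro nn_integral_cong) (auto simp: sp g_def ennreal_mult poisson_nonneg mult.commute)
    also have "\<dots> = (\<integral>\<^sup>+\<zeta>. ennreal (poisson z \<zeta>) \<partial>\<nu>)"
      unfolding \<nu>_def using gm pm by (intro nn_integral_density[symmetric]) auto
    also have "\<dots> \<le> ennreal (T * c) * (\<integral>\<^sup>+\<zeta>. ennreal (poisson z \<zeta>) \<partial>\<mu>)
        + ennreal (T / \<delta>\<^sup>2) * emeasure \<nu> (space \<nu>)"
      unfolding T_def using c d by (intro nn_integral_poisson_le[OF fin fin\<nu> sets sets\<nu> \<xi> t z(1) \<delta>]) auto
    also have "ennreal (T * c) * (\<integral>\<^sup>+\<zeta>. ennreal (poisson z \<zeta>) \<partial>\<mu>) = ennreal (T * c * ?p z)"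
      unfolding nn_integral_poisson(1)[OF fin sets z1] using T c by (intro ennreal_mult'[symmetric]) simp
    also have "ennreal (T / \<delta>\<^sup>2) * emeasure \<nu> (space \<nu>) = ennreal (T / \<delta>\<^sup>2 * V)"
      unfolding V_def \<nu>.emeasure_eq_measure using T by (intro ennreal_mult'[symmetric]) simp
    also have "ennreal (T * c * ?p z) + ennreal (T / \<delta>\<^sup>2 * V) = ennreal (T * c * ?p z + T / \<delta>\<^sup>2 * V)"
      using T c p by (intro ennreal_plus[symmetric]) (auto simp: V_def)
    finally have "q \<le> T * c * ?p z + T / \<delta>\<^sup>2 * V"
      using T c p by (subst (asm) ennreal_le_iff) (auto simp: V_def)
    also have "T * c * ?p z = \<epsilon> / 3 * ?p z" using T by (simp add: c_def)
    also have "T / \<delta>\<^sup>2 * V \<le> \<epsilon> / 3 * ?p z"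
      using mult_left_mono[OF p(2), of "\<epsilon> / 3"] \<epsilon> by simp
    finally have "q \<le> \<epsilon> / 3 * ?p z + \<epsilon> / 3 * ?p z" by simp
    moreover have "0 < \<epsilon> * ?p z" using \<epsilon> p(1) by simp
    ultimately have q: "q < \<epsilon> * ?p z" by linarith
    have "poisson_integral \<mu> f z - ?p z *\<^sub>R f \<xi> = (LINT \<zeta>|\<mu>. poisson z \<zeta> *\<^sub>R (f \<zeta> - f \<xi>))"
    proof -
      have "integrable \<mu> (\<lambda>\<zeta>. poisson z \<zeta>)"
        using integrable_poisson(2)[OF sets integrable_const[of "1::real"] z(2)] by simp
      then have "(LINT \<zeta>|\<mu>. poisson z \<zeta> *\<^sub>R f \<xi>) = (LINT \<zeta>|\<mu>. poisson z \<zeta>) *\<^sub>R f \<xi>"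
        by (intro integral_scaleR_left)
      moreover have "integrable \<mu> (\<lambda>\<zeta>. poisson z \<zeta> *\<^sub>R f \<zeta>)" "integrable \<mu> (\<lambda>\<zeta>. poisson z \<zeta> *\<^sub>R f \<xi>)"
        using f z(2) by (auto intro!: integrable_poisson(2)[OF sets])
      ultimately show ?thesis
        unfolding poisson_integral_def by (simp add: scaleR_diff_right)
    qed
    also have "norm \<dots> \<le> (LINT \<zeta>|\<mu>. norm (poisson z \<zeta> *\<^sub>R (f \<zeta> - f \<xi>)))"
      by (rule integral_norm_bound)
    also have "\<dots> = q"
      unfolding q_def using z1
      by (intro Bochner_Integration.integral_cong) (auto simp: sp g_def poisson_nonneg)
    finally have "norm (poisson_integral \<mu> f z - ?p z *\<^sub>R f \<xi>) < \<epsilon> * ?p z" using q by simp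
    moreover have eq: "(1 / ?p z) *\<^sub>R poisson_integral \<mu> f z - f \<xi> = (1 / ?p z) *\<^sub>R (poisson_integral \<mu> f z - ?p z *\<^sub>R f \<xi>)"
      using p(1) by (simp add: scaleR_diff_right)
    ultimately show ?case
      using p(1) unfolding dist_norm eq by (simp add: pos_divide_less_eq)
  qed
qed

section \<open>The Clark representation\<close>

lemma schur_apply_less:
  assumes b: "b \<in> schur_class" and z: "z \<in> ball 0 1" and v: "v \<noteq> 0"
  shows "norm (b z *v v) < norm v"
proof -
  have "linear ((*v) (b z))" 
    by (rule linearI, rule matrix_vector_right_distrib)
       (simp add: vec_eq_iff matrix_vector_mult_def scaleR_sum_right)
  then have "bounded_linear ((*v) (b z))" by (simp add: linear_conv_bounded_linear)
  then have "norm (b z *v v) \<le> onorm ((*v) (b z)) * norm v" by (rule onorm)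
  also have "\<dots> < 1 * norm v"
    using b z v unfolding schur_class_def by (intro mult_strict_right_mono) auto
  finally show ?thesis by simp
qed

context
  fixes b :: "complex \<Rightarrow> complex^'n^'n" and \<alpha> :: "complex^'n^'n" and z :: complex
  assumes b: "b \<in> schur_class" and \<alpha>: "unitary \<alpha>" and z: "z \<in> ball 0 1"
begin

lemma schur_unitary_apply_less: "v \<noteq> 0 \<Longrightarrow> norm ((b z ** cadj \<alpha>) *v v) < norm v"
  using schur_apply_less[OF b z, of "cadj \<alpha> *v v"] norm_unitary(2)[OF \<alpha>, of v]
  by (metis matrix_vector_mul_assoc norm_eq_zero)

text \<open>With \<open>B = b z ** cadj \<alpha>\<close>, strict contractivity makes
  \<open>1 - B\<close> injective, hence invertible. Evaluating at \<open>(1 - B) u\<close> removes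
  the inverse from the formula for \<open>clark_H\<close>.\<close>

lemma clark_H_apply: "clark_H b \<alpha> z *v ((mat 1 - b z ** cadj \<alpha>) *v u) = u + (b z ** cadj \<alpha>) *v u"
proof -
  let ?A = "mat 1 - b z ** cadj \<alpha>"
  have "x = 0" if "?A *v x = 0" for x
  proof (rule ccontr)
    assume "x \<noteq> 0"
    then have "norm ((b z ** cadj \<alpha>) *v x) < norm x" by (rule schur_unitary_apply_less)
    moreover have "(b z ** cadj \<alpha>) *v x = x" using that by (simp add: matrix_vector_mult_diff_rdistrib)
    ultimately show False by simp
  qed
  then have "invertible ?A"
    unfolding invertible_left_inverse matrix_left_invertible_ker by blast
  then have "matrix_inv ?A ** ?A = mat 1"
    unfolding invertible_def matrix_inv_def by (rule someI2_ex) simp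
  then have "clark_H b \<alpha> z *v (?A *v u) = (mat 1 + b z ** cadj \<alpha>) *v u"
    unfolding clark_H_def by (simp add: matrix_vector_mul_assoc matrix_mul_assoc[symmetric])
  then show ?thesis by (simp add: matrix_vector_mult_add_rdistrib)
qed

text \<open>The mixed terms of the form of \<open>(1 + B) u\<close> against \<open>(1 - B) u\<close>
  are a number minus its conjugate, so the real part is \<open>|u|^2 - |B u|^2\<close>.\<close>

lemma Re_clark_H_form:
  "Re (cdot (clark_H b \<alpha> z *v ((mat 1 - b z ** cadj \<alpha>) *v u)) ((mat 1 - b z ** cadj \<alpha>) *v u)) \<le> (norm u)\<^sup>2"
proof -
  let ?v = "(b z ** cadj \<alpha>) *v u"
  have "cdot (u + ?v) (u - ?v) = cdot u u - cdot ?v ?v + (cdot ?v u - cnj (cdot ?v u))"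
    using cdot_commute[of u ?v] by (simp add: cdot_add_left cdot_diff_right)
  then have "Re (cdot (u + ?v) (u - ?v)) = (norm u)\<^sup>2 - (norm ?v)\<^sup>2" by (simp add: cdot_self)
  then show ?thesis unfolding clark_H_apply by (simp add: matrix_vector_mult_diff_rdistrib)
qed

text \<open>Duality: for \<open>u = (1 - cadj B) e\<close> and \<open>w = (1 - B) u\<close>, the
  square of \<open>|u|\<close> is the product of \<open>e\<close> with \<open>w\<close>. Splitting
  \<open>e\<close> into \<open>y\<close> and \<open>P x / p\<close>, the first part is handled by
  \<open>|w| \<le> 2 |u|\<close>, the second by Cauchy-Schwarz for \<open>P\<close> and the bound on
  the form of \<open>P\<close> at \<open>w\<close>.\<close>

lemma cadj_defect_bound:
  assumes P: "psd P" and p: "0 < p"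
    and form: "\<And>v. Re (cdot (clark_H b \<alpha> z *v v) v) = Re (cdot (P *v v) v)"
  shows "norm (cadj (b z) *v e - cadj \<alpha> *v e)
    \<le> 2 * norm (e - ((1 / p) *\<^sub>R P) *v x) + sqrt (Re (cdot (((1 / p) *\<^sub>R P) *v x) x) / p)"
proof -
  define B where "B = b z ** cadj \<alpha>"
  define R where "R = Re (cdot (P *v x) x)"
  define y where "y = e - ((1 / p) *\<^sub>R P) *v x"
  have R: "0 \<le> R" using P by (simp add: R_def psd_def)
  define u where "u = (mat 1 - cadj B) *v e"
  define w where "w = (mat 1 - B) *v u"
  have "norm (B *v u) \<le> norm u"
    using schur_unitary_apply_less[of u] by (cases "u = 0") (auto simp: B_def)
  then have wu: "norm w \<le> 2 * norm u"
    using norm_triangle_ineq4[of u "B *v u"] by (simp add: w_def matrix_vector_mult_diff_rdistrib)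
  have Pw: "Re (cdot (P *v w) w) \<le> (norm u)\<^sup>2"
    using Re_clark_H_form[of u] form[of w] by (simp add: w_def B_def)
  have "(cmod (cdot (P *v x) w))\<^sup>2 \<le> R * Re (cdot (P *v w) w)"
    unfolding R_def by (rule psd_Cauchy_Schwarz[OF P])
  also have "\<dots> \<le> R * (norm u)\<^sup>2" using Pw R by (rule mult_left_mono)
  also have "\<dots> = (sqrt R * norm u)\<^sup>2" using R by (simp add: power_mult_distrib)
  finally have CS: "cmod (cdot (P *v x) w) \<le> sqrt R * norm u"
    by (rule power2_le_imp_le) (simp add: R)
  have "cdot u u = cdot e w"
    unfolding w_def by (subst u_def, subst cdot_matrix_left) (simp add: cadj_diff)
  also have "e = y + (1 / p) *\<^sub>R (P *v x)" by (simp add: y_def scaleR_matrix_apply)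
  finally have "cdot u u = cdot y w + (1 / p) *\<^sub>R cdot (P *v x) w"
    by (simp only: cdot_add_left cdot_scaleR_left)
  then have "(norm u)\<^sup>2 = cmod (cdot y w + (1 / p) *\<^sub>R cdot (P *v x) w)"
    using cdot_self[of u] by (metis norm_of_real abs_power2)
  also have "\<dots> \<le> cmod (cdot y w) + (1 / p) * cmod (cdot (P *v x) w)"
    using p norm_triangle_ineq[of "cdot y w" "(1 / p) *\<^sub>R cdot (P *v x) w"] by simp
  also have "\<dots> \<le> norm y * (2 * norm u) + (1 / p) * (sqrt R * norm u)"
    using p CS cdot_norm_le[of y w] mult_left_mono[OF wu, of "norm y"]
    by (intro add_mono mult_left_mono) auto
  finally have "norm u * norm u \<le> (2 * norm y + sqrt R / p) * norm u"
    by (simp add: power2_eq_square algebra_simps)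
  then have un: "norm u \<le> 2 * norm y + sqrt R / p"
    using p R by (cases "u = 0") (auto simp: add_nonneg_nonneg)
  \<comment> \<open>Rewritten in terms of \<open>P / p\<close>, the matrix whose boundary limit is
    known; one further division by \<open>p\<close> remains.\<close>
  have "sqrt R / p = sqrt (R / p / p)"
    using p R by (simp add: real_sqrt_divide)
  also have "R / p / p = Re (cdot (((1 / p) *\<^sub>R P) *v x) x) / p"
    by (simp add: R_def scaleR_matrix_apply cdot_scaleR_left)
  finally have sq: "sqrt R / p = sqrt (Re (cdot (((1 / p) *\<^sub>R P) *v x) x) / p)" .
  \<comment> \<open>Multiplication by the unitary \<open>\<alpha>\<close> preserves the norm and
    identifies the defect with \<open>- u\<close>.\<close>
  have "\<alpha> *v (cadj (b z) *v e - cadj \<alpha> *v e) = - u"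
    using \<alpha> by (simp add: u_def B_def cadj_mult matrix_vector_mult_diff_distrib matrix_vector_mul_assoc
        matrix_vector_mult_diff_rdistrib unitary_def)
  then have "norm (cadj (b z) *v e - cadj \<alpha> *v e) = norm u"
    using norm_unitary(1)[OF \<alpha>, of "cadj (b z) *v e - cadj \<alpha> *v e"] by simp
  then show ?thesis using un sq by (simp add: y_def)
qed

end

theorem proposition4p1:
  fixes b :: "complex \<Rightarrow> complex^'n^'n" and \<alpha> :: "complex^'n^'n"
    and M :: "complex set \<Rightarrow> complex^'n^'n" and W :: "complex \<Rightarrow> complex^'n^'n"
    and \<mu>s :: "complex measure"
  assumes "b \<in> schur_class"
    and "unitary \<alpha>"
    and "AC_measure b \<alpha> M"
    and "trace_density M W"
    and "singular_part circle_lebesgue (trace_measure M) \<mu>s"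
  shows "AE \<xi> in \<mu>s. \<forall>e \<in> range (\<lambda>v. W \<xi> *v v).
           nt_limit (\<lambda>z. cadj (b z) *v e) \<xi> (cadj \<alpha> *v e)"
proof -
  let ?\<mu> = "trace_measure M"
  let ?p = "poisson_integral ?\<mu> (\<lambda>_. 1::real)"
  let ?P = "poisson_integral ?\<mu> W"
  have M: "psd_measure M" using assms(3) by (simp add: AC_measure_def)
  have W: "integrable ?\<mu> W" using assms(4) by (simp add: trace_density_def)
  have fin: "finite_measure ?\<mu>" by (rule finite_trace_measure[OF M])
  have form: "Re (cdot (clark_H b \<alpha> z *v v) v) = Re (cdot (?P z *v v) v)" if z: "z \<in> ball 0 1" for z v
  proof -
    obtain J where J: "has_matrix_integral M (\<lambda>\<zeta>. (\<zeta> + z) / (\<zeta> - z)) J"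
      and H: "clark_H b \<alpha> z = mat \<i> ** mat_Im (clark_H b \<alpha> 0) + J"
      using assms(3) z unfolding AC_measure_def by blast
    show ?thesis
      unfolding H using Re_cdot_matrix_integral[OF M assms(4) z J]
      by (simp add: matrix_vector_mult_add_rdistrib cdot_add_left Re_cdot_i_mat_Im)
  qed
  \<comment> \<open>\<open>N\<close> carries \<open>\<mu>s\<close> and has arc length 0; dropping
    the absolutely continuous summand leaves \<open>\<mu>s\<close> dominated by the trace
    measure.\<close>
  obtain N where N: "N \<in> null_sets circle_lebesgue" "emeasure \<mu>s (space \<mu>s - N) = 0"
    and sets\<mu>s: "sets \<mu>s = sets ?\<mu>"
    and le: "\<And>A. A \<in> sets ?\<mu> \<Longrightarrow> emeasure \<mu>s A \<le> emeasure ?\<mu> A"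
    using assms(5) unfolding singular_part_def by (auto simp: le_iff_add add.commute)
  have Nc: "N \<in> sets circle_borel" "emeasure circle_lebesgue N = 0"
    using N(1) sets_circle_lebesgue by auto
  \<comment> \<open>Arc length vanishes on \<open>N\<close>, so at almost every point of
    \<open>N\<close> its ratio to the trace measure on small balls tends to 0.\<close>
  have "AE \<xi> in ?\<mu>. \<xi> \<in> N \<longrightarrow> (\<forall>c>0. \<exists>\<delta>>0. \<forall>s. 0 < s \<and> s < \<delta> \<longrightarrow>
      emeasure circle_lebesgue (sphere 0 1 \<inter> ball \<xi> s) \<le> ennreal c * emeasure ?\<mu> (sphere 0 1 \<inter> ball \<xi> s))"
    by (rule AE_ball_ratio_tendsto_0[OF fin finite_measure_circle_lebesgue sets_trace_measure sets_circle_lebesgue Nc])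
  then have "AE \<xi> in ?\<mu>. \<xi> \<in> N \<longrightarrow> (\<forall>e \<in> range (\<lambda>v. W \<xi> *v v).
           nt_limit (\<lambda>z. cadj (b z) *v e) \<xi> (cadj \<alpha> *v e))"
    using AE_lebesgue_point[OF fin sets_trace_measure W] AE_space
  proof eventually_elim
    case (elim \<xi>)
    have \<xi>: "norm \<xi> = 1" using elim(3) by simp
    show ?case
    proof (intro impI ballI)
      fix e assume "\<xi> \<in> N" "e \<in> range (\<lambda>v. W \<xi> *v v)"
      then obtain x where e: "e = W \<xi> *v x" by blast
      have dens: "\<forall>c>0. \<exists>\<delta>>0. \<forall>s. 0 < s \<and> s < \<delta> \<longrightarrow>
          ennreal s \<le> ennreal c * emeasure ?\<mu> (sphere 0 1 \<inter> ball \<xi> s)"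
      proof (intro allI impI)
        fix c :: real assume "0 < c"
        then obtain \<delta> where \<delta>: "\<delta> > 0" and d: "\<And>s. 0 < s \<and> s < \<delta> \<Longrightarrow> 
          emeasure circle_lebesgue (sphere 0 1 \<inter> ball \<xi> s) \<le> ennreal c * emeasure ?\<mu> (sphere 0 1 \<inter> ball \<xi> s)"
          using elim(1) \<open>\<xi> \<in> N\<close> by blast
        \<comment> \<open>The cap \<open>pi\<close> keeps \<open>s\<close> in the range where the
          arc length of the ball is bounded below by \<open>s\<close>.\<close>
        have "ennreal s \<le> ennreal c * emeasure ?\<mu> (sphere 0 1 \<inter> ball \<xi> s)" if "0 < s" "s < min \<delta> pi" for s
          using emeasure_circle_lebesgue_ball[of \<xi> s] d[of s] that \<xi> by (auto intro: order_trans)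
        then show "\<exists>\<delta>>0. \<forall>s. 0 < s \<and> s < \<delta> \<longrightarrow>
          ennreal s \<le> ennreal c * emeasure ?\<mu> (sphere 0 1 \<inter> ball \<xi> s)"
          using \<delta> by (intro exI[of _ "min \<delta> pi"]) auto
      qed
      show "nt_limit (\<lambda>z. cadj (b z) *v e) \<xi> (cadj \<alpha> *v e)"
        unfolding nt_limit_def
      proof (intro allI impI)
        fix t :: real assume t: "1 < t"
        let ?F = "at \<xi> within stolz t \<xi>"
        have top: "filterlim ?p at_top ?F"
          by (rule poisson_integral_at_top[OF fin sets_trace_measure \<xi> t dens])
        have lim: "((\<lambda>z. (1 / ?p z) *\<^sub>R ?P z) \<longlongrightarrow> W \<xi>) ?F"
          by (rule poisson_integral_ratio_tendsto[OF fin sets_trace_measure W \<xi> t elim(2) top])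
        let ?g = "\<lambda>z. 2 * norm (e - ((1 / ?p z) *\<^sub>R ?P z) *v x)
          + sqrt (Re (cdot (((1 / ?p z) *\<^sub>R ?P z) *v x) x) / ?p z)"
        have "eventually (\<lambda>z. 1 \<le> ?p z) ?F" using top unfolding filterlim_at_top by blast
        then have bd: "eventually (\<lambda>z. norm (cadj (b z) *v e - cadj \<alpha> *v e) \<le> ?g z) ?F"
          using eventually_stolz_near[OF \<xi> zero_less_one]
        proof eventually_elim
          case (elim z)
          then have z: "z \<in> ball 0 1" by (simp add: stolz_def)
          show ?case
            using elim(1) form[OF z]
            by (intro cadj_defect_bound[OF assms(1,2) z psd_poisson_integral[OF assms(4) z]]) auto
        qed
        \<comment> \<open>The numerator converges to the form of \<open>W \<xi>\<close> at
          \<open>x\<close>, while the denominator tends to infinity.\<close>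
        have "((\<lambda>z. Re (cdot (((1 / ?p z) *\<^sub>R ?P z) *v x) x) / ?p z) \<longlongrightarrow> 0) ?F"
          by (rule tendsto_divide_0[OF _ filterlim_at_top_imp_at_infinity[OF top]])
             (rule tendsto_Re, rule bounded_linear.tendsto[OF bounded_linear_cdot_matrix lim])
        then have "((\<lambda>z. sqrt (Re (cdot (((1 / ?p z) *\<^sub>R ?P z) *v x) x) / ?p z)) \<longlongrightarrow> sqrt 0) ?F"
          by (rule tendsto_real_sqrt)
        moreover have "((\<lambda>z. norm (e - ((1 / ?p z) *\<^sub>R ?P z) *v x)) \<longlongrightarrow> norm (e - W \<xi> *v x)) ?F"
          by (intro tendsto_norm tendsto_diff tendsto_const bounded_linear.tendsto[OF bounded_linear_matrix_apply lim])
        ultimately have "(?g \<longlongrightarrow> 2 * norm (e - W \<xi> *v x) + sqrt 0) ?F"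
          by (intro tendsto_add tendsto_mult tendsto_const)
        then have "(?g \<longlongrightarrow> 0) ?F" by (simp add: e)
        from Lim_null_comparison[OF bd this]
        show "((\<lambda>z. cadj (b z) *v e) \<longlongrightarrow> cadj \<alpha> *v e) ?F"
          by (rule LIM_zero_cancel)
      qed
    qed
  qed
  \<comment> \<open>Null sets of the trace measure are null for \<open>\<mu>s\<close>, which
    transfers the statement; as \<open>N\<close> has full \<open>\<mu>s\<close>-measure, the
    restriction to \<open>N\<close> then disappears.\<close>
  moreover have "absolutely_continuous ?\<mu> \<mu>s"
    unfolding absolutely_continuous_def
  proof
    fix A assume "A \<in> null_sets ?\<mu>"
    then show "A \<in> null_sets \<mu>s" using le[of A] sets\<mu>s by (auto simp: null_sets_def)
  qed
  ultimately have "AE \<xi> in \<mu>s. \<xi> \<in> N \<longrightarrow> (\<forall>e \<in> range (\<lambda>v. W \<xi> *v v).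
           nt_limit (\<lambda>z. cadj (b z) *v e) \<xi> (cadj \<alpha> *v e))"
    using absolutely_continuous_AE[OF sets\<mu>s] by blast
  moreover have "AE \<xi> in \<mu>s. \<xi> \<in> N"
  proof (rule AE_I)
    show "{\<xi> \<in> space \<mu>s. \<xi> \<notin> N} \<subseteq> space \<mu>s - N" by blast
    show "space \<mu>s - N \<in> sets \<mu>s" using Nc(1) sets\<mu>s by (intro sets.compl_sets) simp
  qed (rule N(2))
  ultimately show ?thesis by eventually_elim blast
qed

end
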